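(* Let $\lambda\in\mathbb{C}\setminus\{0,1\}$. The quotient of the degree-one foliation on $\mathbb{P}^2$ given by $$\lambda YZ\,\mathrm{d}X-XZ\,\mathrm{d}Y+(1-\lambda)XY\,\mathrm{d}Z=0$$ under the action of the standard quadratic Cremona transformation $(X:Y:Z)\mapsto(YZ:ZX:XY)$ is birationally equivalent to the foliation $\mathcal{G}_\lambda$ of degree three on $\mathbb{P}^2$ given by $$yz(y+z)\{(\lambda+1)x+y+\lambda z\}\,\mathrm{d}x-xz(x+z)\{(\lambda-1)x+(2\lambda-1)y+\lambda z\}\,\mathrm{d}y+xy(x+y)\{(\lambda-1)x-y+(\lambda-2)z\}\,\mathrm{d}z=0.$$
   Context: A foliation of degree $d$ on $\mathbb{P}^2$ is given by a homogeneous $1$-form $A\,\mathrm{d}x+B\,\mathrm{d}y+C\,\mathrm{d}z$ on $\mathbb{C}^3$ with $A,B,C$ homogeneous of degree $d+1$ without common factor and $xA+yB+zC=0$. The Cremona involution $Q(X:Y:Z)=(YZ:ZX:XY)$ preserves the degree-one foliation, which thus induces a foliation on (any birational model of) the quotient surface $\mathbb{P}^2/Q$, whose function field is the field of $Q$-invariant rational functions on $\mathbb{P}^2$. Two foliated surfaces are birationally equivalent if there is a birational map between them taking one foliation to the other. *)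

theory Defs
  imports "HOL-Computational_Algebra.Computational_Algebra"
    "HOL-Computational_Algebra.Field_as_Ring" "HOL-Library.Product_Plus"
begin

section \<open>Polynomials, rational functions and 1-forms in three variables\<close>

text \<open>
  Polynomials in X, Y, Z are iterated univariate polynomials with X innermost: the coefficient of
  \<open>X^i Y^j Z^k\<close> in \<open>p\<close> is \<open>coeff (coeff (coeff p k) j) i\<close>.
\<close>

type_synonym poly3 = "complex poly poly poly"
type_synonym ratfun = "poly3 fract"

definition const3 :: "complex \<Rightarrow> poly3" where "const3 c = [:[:[:c:]:]:]"
definition varX :: poly3 where "varX = [:[:[:0, 1:]:]:]"
definition varY :: poly3 where "varY = [:[:0, 1:]:]"
definition varZ :: poly3 where "varZ = [:0, 1:]"

definition homogeneous :: "nat \<Rightarrow> poly3 \<Rightarrow> bool" where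
  "homogeneous d p \<longleftrightarrow>
     (\<forall>i j k. coeff (coeff (coeff p k) j) i \<noteq> 0 \<longrightarrow> i + j + k = d)"

definition dX :: "poly3 \<Rightarrow> poly3" where "dX = map_poly (map_poly pderiv)"
definition dY :: "poly3 \<Rightarrow> poly3" where "dY = map_poly pderiv"
definition dZ :: "poly3 \<Rightarrow> poly3" where "dZ = pderiv"

definition const_rat :: "complex \<Rightarrow> ratfun" where "const_rat c = to_fract (const3 c)"

definition subst_poly :: "ratfun \<times> ratfun \<times> ratfun \<Rightarrow> poly3 \<Rightarrow> ratfun" where
  "subst_poly = (\<lambda>(a, b, c) p.
     poly (map_poly (\<lambda>q. poly (map_poly (\<lambda>r. poly (map_poly const_rat r) a) q) b) p) c)"

text \<open>
  Meaningful only if the denominator of \<open>f\<close> does not vanish after the substitution.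
\<close>

definition subst_rat :: "ratfun \<times> ratfun \<times> ratfun \<Rightarrow> ratfun \<Rightarrow> ratfun" where
  "subst_rat \<Phi> f = (case quot_of_fract f of (p, q) \<Rightarrow> subst_poly \<Phi> p / subst_poly \<Phi> q)"

text \<open>
  The triple \<open>(A, B, C)\<close> stands for the 1-form \<open>A dX + B dY + C dZ\<close>.
\<close>

type_synonym 'a form = "'a \<times> 'a \<times> 'a"

definition smul :: "ratfun \<Rightarrow> ratfun form \<Rightarrow> ratfun form" where
  "smul h = (\<lambda>(a, b, c). (h * a, h * b, h * c))"

definition rat_form :: "poly3 form \<Rightarrow> ratfun form" where
  "rat_form = (\<lambda>(A, B, C). (to_fract A, to_fract B, to_fract C))"

definition quotient_rule :: "(poly3 \<Rightarrow> poly3) \<Rightarrow> ratfun \<Rightarrow> ratfun" where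
  "quotient_rule D f = (case quot_of_fract f of (p, q) \<Rightarrow> Fract (D p * q - p * D q) (q ^ 2))"

definition diff :: "ratfun \<Rightarrow> ratfun form" where
  "diff f = (quotient_rule dX f, quotient_rule dY f, quotient_rule dZ f)"

definition pullback_form :: "ratfun \<times> ratfun \<times> ratfun \<Rightarrow> ratfun form \<Rightarrow> ratfun form" where
  "pullback_form \<Phi> \<omega> = (case (\<Phi>, \<omega>) of ((a, b, c), (A, B, C)) \<Rightarrow>
     smul (subst_rat \<Phi> A) (diff a) + smul (subst_rat \<Phi> B) (diff b)
       + smul (subst_rat \<Phi> C) (diff c))"


section \<open>Foliations of the projective plane\<close>

definition P2_foliation :: "nat \<Rightarrow> poly3 form \<Rightarrow> bool" where
  "P2_foliation d = (\<lambda>(A, B, C).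
     homogeneous (d + 1) A \<and> homogeneous (d + 1) B \<and> homogeneous (d + 1) C \<and>
     (\<forall>h. h dvd A \<and> h dvd B \<and> h dvd C \<longrightarrow> is_unit h) \<and>
     varX * A + varY * B + varZ * C = 0)"

definition preserves_foliation :: "ratfun \<times> ratfun \<times> ratfun \<Rightarrow> poly3 form \<Rightarrow> bool" where
  "preserves_foliation \<Phi> \<omega> \<longleftrightarrow>
     (\<exists>h. h \<noteq> 0 \<and> pullback_form \<Phi> (rat_form \<omega>) = smul h (rat_form \<omega>))"

definition cremona :: "ratfun \<times> ratfun \<times> ratfun" where
  "cremona = (to_fract (varY * varZ), to_fract (varZ * varX), to_fract (varX * varY))"


section \<open>Foliated surfaces up to birational equivalence\<close>

text \<open>
  A surface, up to birational maps, is represented by its function field \<open>K\<close>, here always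
  realised inside C(X,Y,Z); for the plane it consists of the homogeneous fractions of degree 0.
  Any such \<open>K\<close> is automatically finitely generated over C, being an intermediate field of a
  finitely generated extension, so only the transcendence degree is required.

  In characteristic 0 the module of Kaehler differentials of \<open>K\<close> over C embeds into that of
  C(X,Y,Z), which is free on dX, dY, dZ. So the rational 1-forms on the surface are the sums of
  \<open>f dg\<close> with \<open>f\<close>, \<open>g\<close> in \<open>K\<close>, and pulling back along a field extension inside C(X,Y,Z) does
  not change the triple. A foliation is a one-dimensional \<open>K\<close>-space of rational 1-forms.
\<close>

type_synonym foliated_surface = "ratfun set \<times> ratfun form set"

definition form_sum :: "(ratfun \<times> ratfun) list \<Rightarrow> ratfun form" where
  "form_sum xs = (\<Sum>(f, g)\<leftarrow>xs. smul f (diff g))"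

definition forms_on :: "ratfun set \<Rightarrow> ratfun form set" where
  "forms_on K = form_sum ` {xs. set xs \<subseteq> K \<times> K}"

definition function_field :: "ratfun set \<Rightarrow> bool" where
  "function_field K \<longleftrightarrow>
     range const_rat \<subseteq> K \<and>
     (\<forall>f\<in>K. \<forall>g\<in>K. f + g \<in> K \<and> f * g \<in> K) \<and> (\<forall>f\<in>K. - f \<in> K \<and> inverse f \<in> K)"

text \<open>
  Here \<open>[:r:]\<close> ranges over the polynomials not involving the third variable.
\<close>

definition transcendence_degree_2 :: "ratfun set \<Rightarrow> bool" where
  "transcendence_degree_2 K \<longleftrightarrow> (\<exists>f\<in>K. \<exists>g\<in>K.
     (\<forall>r. r \<noteq> 0 \<longrightarrow> subst_poly (f, g, 0) [:r:] \<noteq> 0) \<and>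
     (\<forall>h\<in>K. \<exists>p. p \<noteq> 0 \<and> subst_poly (f, g, h) p = 0))"

definition is_foliated_surface :: "foliated_surface \<Rightarrow> bool" where
  "is_foliated_surface = (\<lambda>(K, L). function_field K \<and> transcendence_degree_2 K \<and>
     (\<exists>\<eta>\<in>forms_on K. \<eta> \<noteq> 0 \<and> L = {smul f \<eta> |f. f \<in> K}))"

text \<open>
  A birational map from the surface with function field \<open>K\<^sub>1\<close> to the one with function field
  \<open>K\<^sub>2\<close> is given by its pull-back \<open>\<phi>\<close> of rational functions, a C-isomorphism from \<open>K\<^sub>2\<close> onto
  \<open>K\<^sub>1\<close>. It pulls the form \<open>\<Sum> f dg\<close> back to \<open>\<Sum> \<phi>(f) d\<phi>(g)\<close>.
\<close>

definition birational_map :: "ratfun set \<Rightarrow> ratfun set \<Rightarrow> (ratfun \<Rightarrow> ratfun) \<Rightarrow> bool" where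
  "birational_map K\<^sub>1 K\<^sub>2 \<phi> \<longleftrightarrow> bij_betw \<phi> K\<^sub>2 K\<^sub>1 \<and>
     (\<forall>f\<in>K\<^sub>2. \<forall>g\<in>K\<^sub>2. \<phi> (f + g) = \<phi> f + \<phi> g \<and> \<phi> (f * g) = \<phi> f * \<phi> g) \<and>
     (\<forall>c. \<phi> (const_rat c) = const_rat c)"

definition birationally_equivalent :: "foliated_surface \<Rightarrow> foliated_surface \<Rightarrow> bool" where
  "birationally_equivalent S\<^sub>1 S\<^sub>2 \<longleftrightarrow> is_foliated_surface S\<^sub>1 \<and> is_foliated_surface S\<^sub>2 \<and>
     (\<exists>\<phi>. birational_map (fst S\<^sub>1) (fst S\<^sub>2) \<phi> \<and>
        (\<forall>xs. set xs \<subseteq> fst S\<^sub>2 \<times> fst S\<^sub>2 \<longrightarrow>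
           (form_sum (map (map_prod \<phi> \<phi>) xs) \<in> snd S\<^sub>1 \<longleftrightarrow> form_sum xs \<in> snd S\<^sub>2)))"

definition P2_functions :: "ratfun set" where
  "P2_functions = {Fract p q |p q d. q \<noteq> 0 \<and> homogeneous d p \<and> homogeneous d q}"

definition cremona_invariants :: "ratfun set" where
  "cremona_invariants = {f \<in> P2_functions. subst_rat cremona f = f}"

text \<open>
  The foliation induced on the surface with function field \<open>K\<close>: the rational 1-forms of that
  surface whose pull-back is proportional to \<open>\<omega>\<close>.
\<close>

definition induced_foliation :: "ratfun set \<Rightarrow> poly3 form \<Rightarrow> ratfun form set" where
  "induced_foliation K \<omega> = {\<eta> \<in> forms_on K. \<exists>h. \<eta> = smul h (rat_form \<omega>)}"

definition foliated_P2 :: "poly3 form \<Rightarrow> foliated_surface" where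
  "foliated_P2 \<omega> = (P2_functions, induced_foliation P2_functions \<omega>)"

definition cremona_quotient :: "poly3 form \<Rightarrow> foliated_surface" where
  "cremona_quotient \<omega> = (cremona_invariants, induced_foliation cremona_invariants \<omega>)"


section \<open>The two foliations\<close>

definition F_foliation :: "complex \<Rightarrow> poly3 form" where
  "F_foliation l =
     (const3 l * varY * varZ,
      - (varX * varZ),
      const3 (1 - l) * varX * varY)"

definition G_foliation :: "complex \<Rightarrow> poly3 form" where
  "G_foliation l =
     (varY * varZ * (varY + varZ)
        * (const3 (l + 1) * varX + varY + const3 l * varZ),
      - (varX * varZ * (varX + varZ)
        * (const3 (l - 1) * varX + const3 (2 * l - 1) * varY + const3 l * varZ)),
      varX * varY * (varX + varY)
        * (const3 (l - 1) * varX - varY + const3 (l - 2) * varZ))"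

end

theory Submission
  imports Defs
begin

text \<open>
  The quotient is realised by the rational map \<open>\<Phi> = (x : y : z)\<close> of degree two with
  \<open>x = (X - Y)(X + Z)(Y + Z)\<close>, \<open>y = - (X + Y)(X - Z)(Y + Z)\<close>, \<open>z = (X + Y)(X + Z)(Y - Z)\<close>.
  The Cremona involution multiplies all three cubics by \<open>- XYZ\<close>, so \<open>\<Phi>\<close> factors through the
  quotient, and a direct computation shows that \<open>\<Phi>\<close> pulls the form of \<open>\<G>\<^sub>\<lambda>\<close> back to a multiple of
  the given form. To see that the image \<open>R\<close> of the function field of the plane is the whole field
  of invariants, put \<open>a = (X - Z)/(X + Z)\<close> and \<open>b = (Y - Z)/(Y + Z)\<close>. The involution negates
  \<open>a\<close> and \<open>b\<close>, while \<open>a\<^sup>2 = - (x + y + z) y / (z x)\<close> and \<open>b/a = - z/y\<close> belong to \<open>R\<close>; hence every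
  rational function is \<open>r + a s\<close> with \<open>r\<close>, \<open>s\<close> in \<open>R\<close>, and it is invariant only if \<open>s = 0\<close>.
  Everything rests on the chain rule for substitutions and on the fact that three rational
  functions with nonvanishing Jacobian determinant are algebraically independent.
\<close>

section \<open>Substitutions, derivations and the chain rule\<close>

text \<open>Linearity over the constants is left out, so that the notion fits every coefficient ring
  of the iterated polynomials; the chain rule asks for vanishing on constants separately.\<close>

definition derivation :: "('a::comm_ring_1 \<Rightarrow> 'a) \<Rightarrow> bool" where
  "derivation D \<longleftrightarrow> (\<forall>a b. D (a + b) = D a + D b) \<and> (\<forall>a b. D (a * b) = D a * b + a * D b)"

definition rhom :: "('a::comm_ring_1 \<Rightarrow> 'b::comm_ring_1) \<Rightarrow> bool" where
  "rhom h \<longleftrightarrow> h 1 = 1 \<and> (\<forall>a b. h (a + b) = h a + h b) \<and> (\<forall>a b. h (a * b) = h a * h b)"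

lemma derivationD:
  assumes "derivation D"
  shows "D (a + b) = D a + D b" "D (a * b) = D a * b + a * D b" "D 0 = 0" "D 1 = 0"
    "D (- a) = - D a" "D (a - b) = D a - D b"
proof -
  show add: "D (a + b) = D a + D b" for a b using assms by (simp add: derivation_def)
  show mult: "D (a * b) = D a * b + a * D b" for a b using assms by (simp add: derivation_def)
  show zero: "D 0 = 0" using add[of 0 0] by simp
  show "D 1 = 0" using mult[of 1 1] by simp
  show minus: "D (- a) = - D a" for a
    using add[of a "- a"] zero by (simp add: eq_neg_iff_add_eq_0 add.commute)
  show "D (a - b) = D a - D b" using add[of a "- b"] minus[of b] by simp
qed

lemma rhomD:
  assumes "rhom h"
  shows "h (a + b) = h a + h b" "h (a * b) = h a * h b" "h 0 = 0" "h 1 = 1"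
    "h (- a) = - h a" "h (a - b) = h a - h b" "h (a ^ n) = h a ^ n"
proof -
  show add: "h (a + b) = h a + h b" for a b using assms by (simp add: rhom_def)
  show mult: "h (a * b) = h a * h b" for a b using assms by (simp add: rhom_def)
  show zero: "h 0 = 0" using add[of 0 0] by simp
  show one: "h 1 = 1" using assms by (simp add: rhom_def)
  show minus: "h (- a) = - h a" for a
    using add[of a "- a"] zero by (simp add: eq_neg_iff_add_eq_0 add.commute)
  show "h (a - b) = h a - h b" using add[of a "- b"] minus[of b] by simp
  show "h (a ^ n) = h a ^ n" by (induction n) (simp_all add: one mult)
qed

lemma rhom_numeral: "rhom h \<Longrightarrow> h (numeral n) = numeral n"
  by (induction n) (simp_all only: numeral.simps rhomD)

lemma rhom_divide:
  fixes h :: "'a::field \<Rightarrow> 'b::field"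
  assumes "rhom h"
  shows "h x = 0 \<longleftrightarrow> x = 0" "inj h" "h (inverse x) = inverse (h x)" "h (x / y) = h x / h y"
proof -
  show zero: "h x = 0 \<longleftrightarrow> x = 0" for x
    using rhomD(2)[OF assms, of x "inverse x"] rhomD(3,4)[OF assms] by (cases "x = 0") auto
  show "inj h"
    by (rule injI) (metis zero rhomD(6)[OF assms] eq_iff_diff_eq_0)
  show inv: "h (inverse x) = inverse (h x)" for x
    using rhomD(2)[OF assms, of x "inverse x"] rhomD(3,4)[OF assms] zero[of x]
    by (cases "x = 0") (auto simp: field_simps)
  show "h (x / y) = h x / h y"
    by (simp add: divide_inverse rhomD(2)[OF assms] inv)
qed

lemma poly_eval_pCons:
  "h 0 = 0 \<Longrightarrow> poly (map_poly h (pCons q p)) c = h q + c * poly (map_poly h p) c"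
  by (simp add: map_poly_pCons)

text \<open>This handles one layer of the nested polynomials; \<open>subst_poly\<close> applies it
  three times.\<close>

lemma rhom_poly_eval:
  assumes h: "rhom h"
  shows "rhom (\<lambda>p. poly (map_poly h p) c)"
proof -
  note h' = rhomD[OF h]
  have add: "map_poly h (p + q) = map_poly h p + map_poly h q" for p q
    by (intro poly_eqI) (simp add: coeff_map_poly h')
  have sm: "map_poly h (smult a q) = smult (h a) (map_poly h q)" for a q
    by (intro poly_eqI) (simp add: coeff_map_poly h')
  have mult: "poly (map_poly h (p * q)) c = poly (map_poly h p) c * poly (map_poly h q) c" for p q
    by (induction p) (simp_all add: add sm poly_eval_pCons h' algebra_simps)
  show ?thesis
    by (simp add: rhom_def add mult h')
qed

lemma poly_eval_comp:
  assumes h: "rhom h" and g: "g 0 = 0"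
  shows "h (poly (map_poly g p) c) = poly (map_poly (\<lambda>q. h (g q)) p) (h c)"
  by (induction p) (simp_all add: poly_eval_pCons g rhomD[OF h])

lemma rhom_to_fract: "rhom to_fract"
  by (simp add: rhom_def)

lemma rhom_const3: "rhom const3"
  by (auto simp: rhom_def const3_def one_pCons)

lemma rhom_const_rat: "rhom const_rat"
  by (simp add: rhom_def const_rat_def rhomD[OF rhom_const3])

lemma rhom_subst_poly: "rhom (subst_poly \<Phi>)"
  by (cases \<Phi>) (simp add: subst_poly_def rhom_poly_eval rhom_const_rat)

definition sub2 :: "ratfun \<Rightarrow> ratfun \<Rightarrow> complex poly poly \<Rightarrow> ratfun" where
  "sub2 a b = (\<lambda>q. poly (map_poly (\<lambda>r. poly (map_poly const_rat r) a) q) b)"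

lemma rhom_sub2: "rhom (sub2 a b)"
  by (simp add: sub2_def rhom_poly_eval rhom_const_rat)

lemma subst_poly_alt: "subst_poly (a, b, c) p = poly (map_poly (sub2 a b) p) c"
  by (simp add: subst_poly_def sub2_def)

lemma subst_poly_pCons: "subst_poly (a, b, c) (pCons q p) = sub2 a b q + c * subst_poly (a, b, c) p"
  by (simp add: subst_poly_alt poly_eval_pCons rhomD[OF rhom_sub2])

lemma subst_poly_simps:
  "subst_poly (a, b, c) varX = a" "subst_poly (a, b, c) varY = b" "subst_poly (a, b, c) varZ = c"
  "subst_poly (a, b, c) (const3 k) = const_rat k"
  by (simp_all add: subst_poly_def varX_def varY_def varZ_def const3_def map_poly_pCons
      rhomD[OF rhom_const_rat] one_pCons[symmetric])

text \<open>A ring homomorphism that fixes the constants acts on a polynomial expression only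
  through its three arguments.\<close>

lemma subst_poly_comp:
  assumes h: "rhom h" and c: "\<And>k. h (const_rat k) = const_rat k"
  shows "h (subst_poly (x, y, z) p) = subst_poly (h x, h y, h z) p"
  by (simp add: subst_poly_def poly_eval_comp[OF h] rhomD[OF rhom_const_rat] c)

lemma subst_poly_id: "subst_poly (to_fract varX, to_fract varY, to_fract varZ) p = to_fract p"
proof -
  have 1: "poly (map_poly const_rat r) (to_fract varX) = to_fract [:[:r:]:]" for r
  proof (induction r)
    case (pCons a r)
    have "[:[:pCons a r:]:] = const3 a + varX * [:[:r:]:]"
      by (simp add: const3_def varX_def)
    then have "to_fract [:[:pCons a r:]:] = const_rat a + to_fract varX * to_fract [:[:r:]:]"
      by (simp only: const_rat_def to_fract_add to_fract_mult)
    then show ?case using pCons by (simp only: poly_eval_pCons rhomD[OF rhom_const_rat])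
  qed simp
  have 2: "sub2 (to_fract varX) (to_fract varY) q = to_fract [:q:]" for q
    unfolding sub2_def
  proof (induction q)
    case (pCons a q)
    have "[:pCons a q:] = [:[:a:]:] + varY * [:q:]"
      by (simp add: varY_def)
    then have "to_fract [:pCons a q:] = to_fract [:[:a:]:] + to_fract varY * to_fract [:q:]"
      by (simp only: to_fract_add to_fract_mult)
    then show ?case using pCons by (simp add: poly_eval_pCons 1)
  qed simp
  show ?thesis
  proof (induction p)
    case (pCons a p)
    have "pCons a p = [:a:] + varZ * p"
      by (simp add: varZ_def)
    then have "to_fract (pCons a p) = to_fract [:a:] + to_fract varZ * to_fract p"
      by (simp only: to_fract_add to_fract_mult)
    then show ?case using pCons by (simp add: subst_poly_pCons 2)
  qed (simp add: rhomD[OF rhom_subst_poly])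
qed

text \<open>Algebraic independence of the three components. It keeps every denominator nonzero,
  which makes \<open>subst_rat\<close> a field homomorphism.\<close>

definition dominant :: "ratfun \<times> ratfun \<times> ratfun \<Rightarrow> bool" where
  "dominant \<Phi> \<longleftrightarrow> (\<forall>p. p \<noteq> 0 \<longrightarrow> subst_poly \<Phi> p \<noteq> 0)"

section \<open>Substitution into rational functions\<close>

lemma quot_of_fract_Fract:
  assumes "q \<noteq> (0::poly3)" and "quot_of_fract (Fract p q) = (p', q')"
  shows "q' \<noteq> 0" "p' * q = p * q'"
proof -
  show "q' \<noteq> 0" using snd_quot_of_fract_nonzero[of "Fract p q"] assms by simp
  then show "p' * q = p * q'"
    using Fract_quot_of_fract[of "Fract p q"] assms by (simp add: eq_fract)
qed

text \<open>Two representatives of a fraction satisfy a cross-multiplied identity, which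
  substitution preserves; hence the normalised one used in the definition may be exchanged for any
  other.\<close>

lemma subst_rat_Fract:
  assumes "dominant \<Phi>" "q \<noteq> 0"
  shows "subst_rat \<Phi> (Fract p q) = subst_poly \<Phi> p / subst_poly \<Phi> q"
proof -
  obtain p' q' where pq: "quot_of_fract (Fract p q) = (p', q')" by fastforce
  note * = quot_of_fract_Fract[OF assms(2) pq]
  have "subst_poly \<Phi> p' * subst_poly \<Phi> q = subst_poly \<Phi> p * subst_poly \<Phi> q'"
    using *(2) by (metis rhomD(2)[OF rhom_subst_poly])
  moreover have "subst_poly \<Phi> q \<noteq> 0" "subst_poly \<Phi> q' \<noteq> 0"
    using assms * by (auto simp: dominant_def)
  ultimately show ?thesis by (simp add: subst_rat_def pq field_simps)
qed

lemma subst_rat_to_fract: "subst_rat \<Phi> (to_fract p) = subst_poly \<Phi> p"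
  by (simp add: subst_rat_def rhomD[OF rhom_subst_poly])

lemma subst_rat_const: "subst_rat \<Phi> (const_rat c) = const_rat c"
  unfolding const_rat_def subst_rat_to_fract
  by (cases \<Phi>) (simp add: subst_poly_simps const_rat_def)

lemma rhom_subst_rat:
  assumes d: "dominant \<Phi>"
  shows "rhom (subst_rat \<Phi>)"
proof -
  have nz: "subst_poly \<Phi> q \<noteq> 0" if "q \<noteq> 0" for q
    using d that by (auto simp: dominant_def)
  have "subst_rat \<Phi> (f + g) = subst_rat \<Phi> f + subst_rat \<Phi> g \<and>
      subst_rat \<Phi> (f * g) = subst_rat \<Phi> f * subst_rat \<Phi> g" for f g
    by (cases f; cases g)
       (simp add: subst_rat_Fract[OF d] rhomD[OF rhom_subst_poly] nz field_simps)
  then show ?thesis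
    using subst_rat_to_fract[of \<Phi> 1] by (simp add: rhom_def rhomD[OF rhom_subst_poly])
qed

section \<open>Derivations and the chain rule\<close>

lemma quotient_rule_Fract:
  assumes D: "derivation D" and q: "q \<noteq> 0"
  shows "quotient_rule D (Fract p q) = Fract (D p * q - p * D q) (q ^ 2)"
proof -
  obtain p' q' where pq: "quot_of_fract (Fract p q) = (p', q')" by fastforce
  note * = quot_of_fract_Fract[OF q pq]
  \<comment> \<open>Differentiating the cross-multiplied identity relates the derivatives of the two
    representatives.\<close>
  have "D (p' * q) = D (p * q')" using *(2) by simp
  then have "D p' * q + p' * D q = D p * q' + p * D q'"
    by (simp add: derivationD[OF D])
  then have "(D p' * q' - p' * D q') * q ^ 2 = (D p * q - p * D q) * q' ^ 2"
    using *(2) by algebra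
  then show ?thesis using * q by (simp add: quotient_rule_def pq eq_fract)
qed

lemma quotient_rule_to_fract: "derivation D \<Longrightarrow> quotient_rule D (to_fract p) = to_fract (D p)"
  using quotient_rule_Fract[of D 1 p] by (simp add: to_fract_def derivationD)

lemma derivation_quotient_rule:
  assumes D: "derivation D"
  shows "derivation (quotient_rule D)"
proof -
  have "quotient_rule D (f + g) = quotient_rule D f + quotient_rule D g \<and>
      quotient_rule D (f * g) = quotient_rule D f * g + f * quotient_rule D g" for f g
  proof (cases f; cases g)
    fix p q p' q' assume "f = Fract p q" "q \<noteq> 0" "g = Fract p' q'" "q' \<noteq> 0"
    then show ?thesis
      by (simp add: quotient_rule_Fract[OF D] derivationD[OF D] eq_fract power2_eq_square algebra_simps)
  qed
  then show ?thesis by (simp add: derivation_def)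
qed

lemma derivation_map_poly:
  assumes D: "derivation D"
  shows "derivation (map_poly D)"
proof -
  note D' = derivationD[OF D]
  have sum: "D (sum f A) = (\<Sum>i\<in>A. D (f i))" for f and A :: "nat set"
    by (induction A rule: infinite_finite_induct) (simp_all add: D')
  show ?thesis
    unfolding derivation_def
    by (auto intro!: poly_eqI simp: coeff_map_poly D' coeff_mult sum sum.distrib)
qed

lemma derivation_pderiv: "derivation pderiv"
  by (simp add: derivation_def pderiv_add pderiv_mult algebra_simps)

lemma derivation_partial: "derivation dX" "derivation dY" "derivation dZ"
  unfolding dX_def dY_def dZ_def
  by (intro derivation_map_poly derivation_pderiv)+

lemma partial_var:
  "dX varX = 1" "dX varY = 0" "dX varZ = 0" "dX (const3 c) = 0"
  "dY varX = 0" "dY varY = 1" "dY varZ = 0" "dY (const3 c) = 0"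
  "dZ varX = 0" "dZ varY = 0" "dZ varZ = 1" "dZ (const3 c) = 0"
  by (simp_all add: dX_def dY_def dZ_def varX_def varY_def varZ_def const3_def map_poly_pCons
      pderiv_pCons one_pCons)

text \<open>Induction over each layer in turn: first X alone (\<open>1\<close>), then X and Y
  (\<open>2\<close>), then all three variables. Each layer contributes one more partial
  derivative.\<close>

lemma chain_rule_poly:
  assumes E: "derivation E" and c: "\<And>k. E (const_rat k) = 0"
  shows "E (subst_poly (x, y, z) p) = subst_poly (x, y, z) (dX p) * E x +
    subst_poly (x, y, z) (dY p) * E y + subst_poly (x, y, z) (dZ p) * E z"
proof -
  note E' = derivationD[OF E]
  let ?s = "\<lambda>r. poly (map_poly const_rat r) x"
  note s = rhomD[OF rhom_poly_eval[OF rhom_const_rat, of x]]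
  have 1: "E (?s r) = ?s (pderiv r) * E x" for r
    by (induction r)
       (simp_all add: E' s poly_eval_pCons rhomD[OF rhom_const_rat] c pderiv_pCons algebra_simps)
  have 2: "E (sub2 x y q) = sub2 x y (map_poly pderiv q) * E x + sub2 x y (pderiv q) * E y" for q
  proof (induction q)
    case (pCons a q)
    have eq: "sub2 x y (pCons a q) = ?s a + y * sub2 x y q" for a q
      unfolding sub2_def by (rule poly_eval_pCons) simp
    show ?case
      by (simp add: E' eq 1 pCons map_poly_pCons pderiv_pCons rhomD[OF rhom_sub2] algebra_simps)
  qed (simp add: rhomD[OF rhom_sub2] E')
  show ?thesis
  proof (induction p)
    case (pCons a p)
    show ?case
      by (simp add: E' subst_poly_pCons 2 pCons dX_def dY_def dZ_def map_poly_pCons pderiv_pCons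
          rhomD[OF rhom_subst_poly] rhomD[OF rhom_sub2])
        (simp add: pCons[unfolded dX_def dY_def dZ_def] algebra_simps)
  qed (simp add: rhomD[OF rhom_subst_poly] E' derivationD[OF derivation_partial(1)]
      derivationD[OF derivation_partial(2)] derivationD[OF derivation_partial(3)])
qed

section \<open>Algebraic independence from the Jacobian determinant\<close>

lemma coeff_of_nat_mult: "coeff (of_nat n * p) i = of_nat n * coeff (p :: 'a::comm_ring_1 poly) i"
  by (simp add: of_nat_poly)

lemma coeff_partial:
  "coeff (coeff (coeff (dX p) k) j) i = of_nat (Suc i) * coeff (coeff (coeff p k) j) (Suc i)"
  "coeff (coeff (coeff (dY p) k) j) i = of_nat (Suc j) * coeff (coeff (coeff p k) (Suc j)) i"
  "coeff (coeff (coeff (dZ p) k) j) i = of_nat (Suc k) * coeff (coeff (coeff p (Suc k)) j) i"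
  by (simp_all add: dX_def dY_def dZ_def coeff_map_poly coeff_pderiv coeff_of_nat_mult
      del: of_nat_Suc)

lemma poly3_eqI:
  assumes "\<And>i j k. coeff (coeff (coeff p k) j) i = coeff (coeff (coeff q k) j) i"
  shows "p = (q :: poly3)"
  by (intro poly_eqI assms)

text \<open>Any bound will do: the finitely many candidate exponents lie in \<open>S\<close>, and
  the sum of all their total degrees dominates each one.\<close>

lemma total_degree_bound:
  fixes p :: poly3
  obtains n where "\<And>i j k. coeff (coeff (coeff p k) j) i \<noteq> 0 \<Longrightarrow> i + j + k \<le> n"
proof -
  define S where "S = (SIGMA k:{..degree p}. SIGMA j:{..degree (coeff p k)}.
    {..degree (coeff (coeff p k) j)})"
  have "finite S" by (simp add: S_def)
  have "i + j + k \<le> (\<Sum>(k, j, i)\<in>S. i + j + k)" if "coeff (coeff (coeff p k) j) i \<noteq> 0" for i j k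
  proof -
    have "coeff (coeff p k) j \<noteq> 0" "coeff p k \<noteq> 0" using that by auto
    then have "(k, j, i) \<in> S" using that by (auto simp: S_def intro: le_degree)
    from member_le_sum[OF this _ \<open>finite S\<close>, of "\<lambda>(k, j, i). i + j + k"] show ?thesis by simp
  qed
  then show ?thesis using that by blast
qed

definition jacobian :: "ratfun \<times> ratfun \<times> ratfun \<Rightarrow> ratfun" where
  "jacobian = (\<lambda>(a, b, c). case (diff a, diff b, diff c) of
     ((a1, a2, a3), (b1, b2, b3), (c1, c2, c3)) \<Rightarrow>
       a1 * (b2 * c3 - b3 * c2) - a2 * (b1 * c3 - b3 * c1) + a3 * (b1 * c2 - b2 * c1))"

text \<open>Combining the three equations with cofactors of the matrix yields each unknown times the
  determinant.\<close>

lemma cramer3: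
  fixes A :: "'a::idom"
  assumes "a1 * (b2 * c3 - b3 * c2) - a2 * (b1 * c3 - b3 * c1) + a3 * (b1 * c2 - b2 * c1) \<noteq> 0"
    and "A * a1 + B * b1 + C * c1 = 0" "A * a2 + B * b2 + C * c2 = 0" "A * a3 + B * b3 + C * c3 = 0"
  shows "A = 0 \<and> B = 0 \<and> C = 0"
proof -
  let ?d = "a1 * (b2 * c3 - b3 * c2) - a2 * (b1 * c3 - b3 * c1) + a3 * (b1 * c2 - b2 * c1)"
  have "A * ?d = 0" "B * ?d = 0" "C * ?d = 0" using assms(2-4) by algebra+
  then show ?thesis using assms(1) by simp
qed

lemma diff_independent:
  assumes "jacobian (a, b, c) \<noteq> 0"
    and "smul A (diff a) + smul B (diff b) + smul C (diff c) = 0"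
  shows "A = 0 \<and> B = 0 \<and> C = 0"
proof -
  obtain a1 a2 a3 b1 b2 b3 c1 c2 c3 where
    "diff a = (a1, a2, a3)" "diff b = (b1, b2, b3)" "diff c = (c1, c2, c3)"
    by (metis prod_cases3)
  then show ?thesis
    using assms cramer3[of a1 b2 c3 b3 c2 a2 b1 c1 a3 A B C]
    by (simp add: jacobian_def smul_def zero_prod_def)
qed

lemma diff_const: "diff (const_rat c) = 0"
  by (simp add: diff_def const_rat_def quotient_rule_to_fract derivation_partial partial_var
      zero_prod_def)

lemma diff_subst_poly:
  "diff (subst_poly (a, b, c) p) = smul (subst_poly (a, b, c) (dX p)) (diff a) +
     smul (subst_poly (a, b, c) (dY p)) (diff b) + smul (subst_poly (a, b, c) (dZ p)) (diff c)"
proof -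
  have "quotient_rule D (const_rat k) = 0" if "D \<in> {dX, dY, dZ}" for D k
    using diff_const[of k] that by (auto simp: diff_def zero_prod_def)
  then show ?thesis
    by (simp add: diff_def smul_def chain_rule_poly derivation_quotient_rule derivation_partial)
qed

text \<open>
  A nonzero relation of minimal total degree would have all its partial derivatives as smaller
  relations, because the Jacobian matrix is invertible.
\<close>
lemma dominant_jacobian:
  assumes J: "jacobian \<Phi> \<noteq> 0"
  shows "dominant \<Phi>"
proof -
  obtain a b c where \<Phi>: "\<Phi> = (a, b, c)" by (cases \<Phi>)
  have "p = 0" if "subst_poly \<Phi> p = 0"
    "\<And>i j k. coeff (coeff (coeff p k) j) i \<noteq> 0 \<Longrightarrow> i + j + k \<le> n" for n p
    using that
  proof (induction n arbitrary: p)
    case 0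
    have "p = const3 (coeff (coeff (coeff p 0) 0) 0)"
    proof (rule poly3_eqI)
      fix i j k
      show "coeff (coeff (coeff p k) j) i =
          coeff (coeff (coeff (const3 (coeff (coeff (coeff p 0) 0) 0)) k) j) i"
        using "0.prems"(2)[of k j i] by (auto simp: const3_def coeff_pCons split: nat.splits)
    qed
    moreover have "subst_poly \<Phi> (const3 k) = const_rat k" for k
      by (simp add: \<Phi> subst_poly_simps)
    ultimately show ?case
      using 0(1) rhom_const_rat
      by (metis const3_def const_rat_def pCons_0_0 to_fract_eq_0_iff)
  next
    case (Suc n)
    have "subst_poly \<Phi> (dX p) = 0 \<and> subst_poly \<Phi> (dY p) = 0 \<and> subst_poly \<Phi> (dZ p) = 0"
      using J Suc.prems(1) diff_subst_poly[of a b c p] diff_const[of 0]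
      unfolding \<Phi> by (intro diff_independent) (simp_all add: const_rat_def const3_def)
    \<comment> \<open>A coefficient of a partial derivative is a multiple of a coefficient of
      \<open>p\<close> with one exponent raised by one, so the degree bound drops.\<close>
    moreover have "i + j + k \<le> n" if "coeff (coeff (coeff (D p) k) j) i \<noteq> 0" "D \<in> {dX, dY, dZ}"
      for i j k D
      using that Suc.prems(2)[of k j "Suc i"] Suc.prems(2)[of k "Suc j" i] Suc.prems(2)[of "Suc k" j i]
      by (auto simp: coeff_partial)
    ultimately have "dX p = 0" "dY p = 0" "dZ p = 0"
      by (intro Suc.IH; blast)+
    then have *: "coeff (coeff (coeff p k) j) (Suc i) = 0" "coeff (coeff (coeff p k) (Suc j)) i = 0"
      "coeff (coeff (coeff p (Suc k)) j) i = 0" for i j k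
      using coeff_partial[of p k j i] by (simp_all del: of_nat_Suc)
    show ?case
    \<comment> \<open>In characteristic 0 only the constant coefficient survives when all partial
      derivatives vanish. So \<open>p\<close> itself meets the smaller bound and the induction
      hypothesis applies to it.\<close>
    proof (rule Suc.IH[OF Suc.prems(1)])
      fix i j k assume "coeff (coeff (coeff p k) j) i \<noteq> 0"
      then have "i = 0 \<and> j = 0 \<and> k = 0" using * by (metis not0_implies_Suc)
      then show "i + j + k \<le> n" by simp
    qed
  qed
  then show ?thesis
    unfolding dominant_def by (metis total_degree_bound)
qed

section \<open>Homogeneous polynomials and function fields\<close>

lemma homogeneous_0: "homogeneous d 0"
  by (simp add: homogeneous_def)

lemma homogeneous_add: "homogeneous d p \<Longrightarrow> homogeneous d q \<Longrightarrow> homogeneous d (p + q)"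
  unfolding homogeneous_def by (metis add.right_neutral coeff_add)

lemma homogeneous_uminus: "homogeneous d p \<Longrightarrow> homogeneous d (- p)"
  by (simp add: homogeneous_def)

lemma homogeneous_diff: "homogeneous d p \<Longrightarrow> homogeneous d q \<Longrightarrow> homogeneous d (p - q)"
  using homogeneous_add[of d p "- q"] by (simp add: homogeneous_uminus)

lemma homogeneous_mult:
  assumes "homogeneous d p" "homogeneous e q"
  shows "homogeneous (d + e) (p * q)"
  unfolding homogeneous_def
proof (intro allI impI)
  fix i j k assume "coeff (coeff (coeff (p * q) k) j) i \<noteq> 0"
  then have "(\<Sum>k'\<le>k. \<Sum>j'\<le>j. \<Sum>i'\<le>i. coeff (coeff (coeff p k') j') i' *
      coeff (coeff (coeff q (k - k')) (j - j')) (i - i')) \<noteq> 0"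
    by (simp add: coeff_mult coeff_sum)
  then obtain k' j' i' where le: "k' \<le> k" "j' \<le> j" "i' \<le> i" and
    "coeff (coeff (coeff p k') j') i' * coeff (coeff (coeff q (k - k')) (j - j')) (i - i') \<noteq> 0"
    by (metis (no_types, lifting) atMost_iff sum.not_neutral_contains_not_neutral)
  then have "coeff (coeff (coeff p k') j') i' \<noteq> 0"
    "coeff (coeff (coeff q (k - k')) (j - j')) (i - i') \<noteq> 0" by auto
  then have "i' + j' + k' = d" "(i - i') + (j - j') + (k - k') = e"
    using assms unfolding homogeneous_def by blast+
  then show "i + j + k = d + e" using le by linarith
qed

lemma homogeneous_atoms:
  "homogeneous 0 (const3 c)" "homogeneous (Suc 0) varX" "homogeneous (Suc 0) varY"
  "homogeneous (Suc 0) varZ"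
  by (auto simp: homogeneous_def const3_def varX_def varY_def varZ_def coeff_pCons split: nat.splits)

text \<open>The factor Z restores the degree lost by differentiation, which avoids the truncated
  \<open>d - 1\<close>; for \<open>d = 0\<close> the derivative is zero.\<close>

lemma homogeneous_varZ_partial:
  assumes "homogeneous d p" "D \<in> {dX, dY, dZ}"
  shows "homogeneous d (varZ * D p)"
proof (cases d)
  case 0
  have "D p = 0"
    using assms unfolding 0
    by (intro poly3_eqI) (force simp: coeff_partial homogeneous_def simp del: of_nat_Suc)
  then show ?thesis by (simp add: homogeneous_0)
next
  case (Suc e)
  have "i + j + k = e" if "coeff (coeff (coeff (D p) k) j) i \<noteq> 0" for i j k
  proof -
    have *: "coeff (coeff (coeff p k) j) i \<noteq> 0 \<Longrightarrow> i + j + k = Suc e" for i j k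
      using assms(1) unfolding Suc homogeneous_def by blast
    show ?thesis
      using assms(2) that *[of k j "Suc i"] *[of k "Suc j" i] *[of "Suc k" j i]
      by (auto simp: coeff_partial simp del: of_nat_Suc)
  qed
  then have "homogeneous e (D p)"
    by (simp add: homogeneous_def)
  from homogeneous_mult[OF homogeneous_atoms(4) this] show ?thesis by (simp add: Suc)
qed

lemma poly_eval_sum:
  fixes c :: "'a::comm_ring_1"
  assumes "h 0 = 0"
  shows "poly (map_poly h p) c = (\<Sum>k\<le>degree p. h (coeff p k) * c ^ k)"
proof -
  have "poly (map_poly h p) c = (\<Sum>k\<le>n. h (coeff p k) * c ^ k)" if "degree p \<le> n" for n
    using that
  proof (induction p arbitrary: n)
    case (pCons a p)
    show ?case
    proof (cases n)
      case 0
      then have "p = 0" using pCons by (auto split: if_splits)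
      then show ?thesis using 0 assms by (simp add: poly_eval_pCons)
    next
      case (Suc m)
      then have "degree p \<le> m" using pCons by (auto split: if_splits)
      from pCons.IH[OF this] show ?thesis
        by (simp add: Suc poly_eval_pCons assms sum.atMost_Suc_shift sum_distrib_left algebra_simps
            del: sum.atMost_Suc)
    qed
  qed (simp add: assms)
  then show ?thesis by simp
qed

text \<open>One layer of the scaling law for homogeneous polynomials: the coefficient of the
  \<open>k\<close>-th power supplies the remaining \<open>d - k\<close> factors of \<open>s\<close>.
  The condition \<open>k \<le> d\<close> keeps that subtraction exact.\<close>

lemma poly_eval_scale:
  fixes s :: "'a::comm_ring_1"
  assumes h: "h 0 = 0" "h' 0 = 0"
    and "\<And>k. coeff p k \<noteq> 0 \<Longrightarrow> k \<le> d \<and> h' (coeff p k) = s ^ (d - k) * h (coeff p k)"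
  shows "poly (map_poly h' p) (s * c) = s ^ d * poly (map_poly h p) c"
proof -
  have "h' (coeff p k) * (s * c) ^ k = s ^ d * (h (coeff p k) * c ^ k)" for k
  proof (cases "coeff p k = 0")
    case False
    then have "s ^ d = s ^ (d - k) * s ^ k" using assms(3) by (simp flip: power_add)
    then show ?thesis using assms(3)[OF False] by (simp add: power_mult_distrib algebra_simps)
  qed (simp add: h)
  then show ?thesis by (simp add: poly_eval_sum h sum_distrib_left)
qed

lemma subst_poly_homogeneous:
  assumes p: "homogeneous d p"
  shows "subst_poly (s * a, s * b, s * c) p = s ^ d * subst_poly (a, b, c) p"
  unfolding subst_poly_alt
proof (rule poly_eval_scale)
  fix k assume k: "coeff p k \<noteq> 0"
  have *: "coeff (coeff (coeff p k) j) i \<noteq> 0 \<Longrightarrow> i + j + k = d" for i j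
    using p by (simp add: homogeneous_def)
  \<comment> \<open>The leading exponents in Y and X single out a monomial with Z-exponent
    \<open>k\<close> that really occurs, so \<open>k\<close> is at most the total degree.\<close>
  from *[of "degree (coeff p k)" "degree (lead_coeff (coeff p k))"] have "k \<le> d"
    using k by simp
  moreover have "sub2 (s * a) (s * b) (coeff p k) = s ^ (d - k) * sub2 a b (coeff p k)"
    unfolding sub2_def
  proof (rule poly_eval_scale)
    fix j assume j: "coeff (coeff p k) j \<noteq> 0"
    with *[of j "degree (coeff (coeff p k) j)"] have "j \<le> d - k" by simp
    moreover have "poly (map_poly const_rat (coeff (coeff p k) j)) (s * a) =
        s ^ (d - k - j) * poly (map_poly const_rat (coeff (coeff p k) j)) a"
    proof (rule poly_eval_scale)
      fix i assume "coeff (coeff (coeff p k) j) i \<noteq> 0"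
      then have "d - k - j = i" using * by force
      then show "i \<le> d - k - j \<and> const_rat (coeff (coeff (coeff p k) j) i) =
          s ^ (d - k - j - i) * const_rat (coeff (coeff (coeff p k) j) i)" by simp
    qed (simp_all add: rhomD[OF rhom_const_rat])
    ultimately show "j \<le> d - k \<and> poly (map_poly const_rat (coeff (coeff p k) j)) (s * a) =
        s ^ (d - k - j) * poly (map_poly const_rat (coeff (coeff p k) j)) a" ..
  qed simp_all
  ultimately show "k \<le> d \<and> sub2 (s * a) (s * b) (coeff p k) = s ^ (d - k) * sub2 a b (coeff p k)" ..
qed (simp_all add: rhomD[OF rhom_sub2])

section \<open>Fields of rational functions containing the constants\<close>

lemma function_fieldI:
  assumes "\<And>c. const_rat c \<in> K" "\<And>f g. f \<in> K \<Longrightarrow> g \<in> K \<Longrightarrow> f + g \<in> K \<and> f * g \<in> K"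
    and "\<And>f. f \<in> K \<Longrightarrow> - f \<in> K \<and> inverse f \<in> K"
  shows "function_field K"
  using assms by (auto simp: function_field_def)

lemma function_fieldD:
  assumes "function_field K"
  shows "const_rat c \<in> K" "0 \<in> K" "1 \<in> K" "f \<in> K \<Longrightarrow> - f \<in> K" "f \<in> K \<Longrightarrow> inverse f \<in> K"
    "f \<in> K \<Longrightarrow> g \<in> K \<Longrightarrow> f + g \<in> K" "f \<in> K \<Longrightarrow> g \<in> K \<Longrightarrow> f - g \<in> K"
    "f \<in> K \<Longrightarrow> g \<in> K \<Longrightarrow> f * g \<in> K" "f \<in> K \<Longrightarrow> g \<in> K \<Longrightarrow> f / g \<in> K"
proof -
  show const: "const_rat c \<in> K" for c using assms by (auto simp: function_field_def)
  show "0 \<in> K" "1 \<in> K" using const[of 0] const[of 1] by (simp_all add: rhomD[OF rhom_const_rat])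
  show minus: "f \<in> K \<Longrightarrow> - f \<in> K" and inv: "f \<in> K \<Longrightarrow> inverse f \<in> K"
    and add: "f \<in> K \<Longrightarrow> g \<in> K \<Longrightarrow> f + g \<in> K" and mult: "f \<in> K \<Longrightarrow> g \<in> K \<Longrightarrow> f * g \<in> K" for f g
    using assms by (auto simp: function_field_def)
  show "f \<in> K \<Longrightarrow> g \<in> K \<Longrightarrow> f - g \<in> K" using add[of f "- g"] minus by simp
  show "f \<in> K \<Longrightarrow> g \<in> K \<Longrightarrow> f / g \<in> K" using mult[of f "inverse g"] inv by (simp add: divide_inverse)
qed

lemma poly_eval_in_field:
  assumes K: "function_field K" and c: "c \<in> K" and "\<And>q. h q \<in> K" "h 0 = 0"
  shows "poly (map_poly h p) c \<in> K"
  using assms(3,4) by (induction p) (simp_all add: poly_eval_pCons function_fieldD[OF K] c)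

lemma subst_poly_in_field:
  assumes K: "function_field K" and "a \<in> K" "b \<in> K" "c \<in> K"
  shows "subst_poly (a, b, c) p \<in> K"
  unfolding subst_poly_def
  using assms by (auto intro!: poly_eval_in_field[OF K] function_fieldD(1)[OF K]
      simp: rhomD[OF rhom_const_rat])

lemma function_field_image:
  assumes K: "function_field K" and h: "rhom h" and c: "\<And>k. h (const_rat k) = const_rat k"
  shows "function_field (h ` K)"
proof -
  have "const_rat k \<in> h ` K" for k
    using c[of k] function_fieldD(1)[OF K, of k] by (metis imageI)
  moreover have "inverse (h x) \<in> h ` K" if "x \<in> K" for x
    using that function_fieldD(5)[OF K, of x] rhom_divide(3)[OF h, of x] by (metis imageI)
  moreover have "- h x \<in> h ` K" if "x \<in> K" for x
    using that function_fieldD(4)[OF K, of x] rhomD(5)[OF h, of x] by (metis imageI)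
  moreover have "h x + h y \<in> h ` K \<and> h x * h y \<in> h ` K" if "x \<in> K" "y \<in> K" for x y
    using that function_fieldD(6,8)[OF K, of x y] rhomD(1,2)[OF h, of x y] by (metis imageI)
  ultimately show ?thesis by (auto simp: function_field_def)
qed

lemma function_field_vimage:
  assumes K: "function_field K" and h: "rhom h" and c: "\<And>k. h (const_rat k) = const_rat k"
  shows "function_field (h -` K)"
  using function_fieldD[OF K] by (auto simp: function_field_def c rhomD[OF h] rhom_divide[OF h])

lemma function_field_Int:
  "function_field K \<Longrightarrow> function_field L \<Longrightarrow> function_field (K \<inter> L)"
  by (auto simp: function_field_def)

lemma function_field_fixed:
  assumes h: "rhom h" and c: "\<And>k. h (const_rat k) = const_rat k"
  shows "function_field {f. h f = f}"
  by (auto simp: function_field_def c rhomD[OF h] rhom_divide[OF h])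

section \<open>The function field of the plane\<close>

lemma P2_functionsI:
  "q \<noteq> 0 \<Longrightarrow> homogeneous d p \<Longrightarrow> homogeneous d q \<Longrightarrow> Fract p q \<in> P2_functions"
  unfolding P2_functions_def by blast

lemma function_field_P2: "function_field P2_functions"
proof -
  have "const_rat c \<in> P2_functions" for c
    using P2_functionsI[of 1 0 "const3 c"] homogeneous_atoms(1)[of c] homogeneous_atoms(1)[of 1]
    by (simp add: const_rat_def to_fract_def rhomD[OF rhom_const3])
  moreover have "f + g \<in> P2_functions \<and> f * g \<in> P2_functions"
    if fg: "f \<in> P2_functions" "g \<in> P2_functions" for f g
  proof -
    obtain p q d where f: "f = Fract p q" "q \<noteq> 0" "homogeneous d p" "homogeneous d q"
      using fg by (auto simp: P2_functions_def)
    obtain p' q' d' where g: "g = Fract p' q'" "q' \<noteq> 0" "homogeneous d' p'" "homogeneous d' q'"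
      using fg by (auto simp: P2_functions_def)
    note h = homogeneous_mult[OF f(3) g(3)] homogeneous_mult[OF f(3) g(4)]
      homogeneous_mult[OF f(4) g(4)] homogeneous_mult[OF g(3) f(4)]
    show ?thesis
      using f g h by (auto intro!: P2_functionsI[of _ "d + d'"] homogeneous_add simp: add.commute mult.commute)
  qed
  moreover have "- f \<in> P2_functions \<and> inverse f \<in> P2_functions" if f0: "f \<in> P2_functions" for f
  proof -
    obtain p q d where f: "f = Fract p q" "q \<noteq> 0" "homogeneous d p" "homogeneous d q"
      using f0 by (auto simp: P2_functions_def)
    show ?thesis
    proof (cases "p = 0")
      case True
      then show ?thesis using f f0 by (simp add: eq_fract fract_collapse)
    next
      case False
      then show ?thesis using f by (auto intro!: P2_functionsI[of _ d] homogeneous_uminus)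
    qed
  qed
  ultimately show ?thesis by (rule function_fieldI)
qed

text \<open>Dehomogenisation: the identity substitution is rescaled by 1/Z.\<close>

lemma to_fract_homogeneous:
  assumes "homogeneous d p"
  shows "subst_poly (to_fract varX / to_fract varZ, to_fract varY / to_fract varZ, 1) p =
    to_fract p / to_fract varZ ^ d"
proof -
  have z: "to_fract varZ \<noteq> 0" by (simp add: varZ_def)
  show ?thesis
    using subst_poly_homogeneous[OF assms, of "inverse (to_fract varZ)" "to_fract varX"
        "to_fract varY" "to_fract varZ"] z
    by (simp add: subst_poly_id divide_inverse mult.commute power_inverse)
qed

text \<open>In a quotient of two forms of equal degree the powers of Z cancel after
  dehomogenisation, leaving a rational function of X/Z and Y/Z. Inclusions of the whole field thus
  reduce to two generators.\<close>

lemma P2_functions_generated: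
  assumes K: "function_field K" and "to_fract varX / to_fract varZ \<in> K" "to_fract varY / to_fract varZ \<in> K"
  shows "P2_functions \<subseteq> K"
proof
  fix f assume "f \<in> P2_functions"
  then obtain p q d where f: "f = Fract p q" "q \<noteq> 0" "homogeneous d p" "homogeneous d q"
    by (auto simp: P2_functions_def)
  let ?s = "subst_poly (to_fract varX / to_fract varZ, to_fract varY / to_fract varZ, 1)"
  have z: "to_fract varZ \<noteq> 0" by (simp add: varZ_def)
  have "f = ?s p / ?s q"
    using f z by (simp add: to_fract_homogeneous Fract_conv_to_fract)
  then show "f \<in> K"
    using assms function_fieldD(3)[OF K] by (auto intro!: function_fieldD(9)[OF K] subst_poly_in_field)
qed

lemma P2_functions_quotient:
  assumes "homogeneous d p"
  shows "to_fract p / to_fract varZ ^ d \<in> P2_functions"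
proof -
  have "homogeneous n (varZ ^ n)" for n
    by (induction n) (use homogeneous_mult[OF homogeneous_atoms(4)] homogeneous_atoms(1)[of 1]
        in \<open>auto simp: rhomD[OF rhom_const3]\<close>)
  moreover have "varZ ^ d \<noteq> 0" by (simp add: varZ_def)
  ultimately have "Fract p (varZ ^ d) \<in> P2_functions"
    using assms by (intro P2_functionsI)
  then show ?thesis by (simp add: Fract_conv_to_fract rhomD(7)[OF rhom_to_fract])
qed

lemma P2_functions_partial:
  assumes "f \<in> P2_functions" "D \<in> {dX, dY, dZ}"
  shows "to_fract varZ * quotient_rule D f \<in> P2_functions"
proof -
  obtain p q d where f: "f = Fract p q" "q \<noteq> 0" "homogeneous d p" "homogeneous d q"
    using assms(1) by (auto simp: P2_functions_def)
  have "to_fract varZ * quotient_rule D f = Fract ((varZ * D p) * q - p * (varZ * D q)) (q * q)"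
    using assms(2) f derivation_partial
    by (auto simp: quotient_rule_Fract to_fract_def power2_eq_square algebra_simps)
  also have "\<dots> \<in> P2_functions"
    using assms(2) f by (intro P2_functionsI[of _ "d + d"] homogeneous_diff homogeneous_mult
        homogeneous_varZ_partial) auto
  finally show ?thesis .
qed

section \<open>Pulling back foliated surfaces\<close>

lemma smul_simps:
  "smul h (\<omega> + \<eta>) = smul h \<omega> + smul h \<eta>" "smul (g + h) \<omega> = smul g \<omega> + smul h \<omega>"
  "smul g (smul h \<omega>) = smul (g * h) \<omega>" "smul 1 \<omega> = \<omega>" "smul h 0 = 0" "smul 0 \<omega> = 0"
  by (cases \<omega>; cases \<eta>; simp add: smul_def zero_prod_def algebra_simps)+

text \<open>With \<open>f\<close> = \<open>p\<close>/\<open>q\<close>, both sides are compared after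
  differentiating \<open>f\<close> times \<open>q\<close> = \<open>p\<close>, once before and once
  after substitution; the polynomial chain rule treats \<open>p\<close> and
  \<open>q\<close>.\<close>

lemma chain_rule_rat:
  assumes d: "dominant (a, b, c)" and E: "derivation E" and const: "\<And>k. E (const_rat k) = 0"
  defines "s \<equiv> subst_rat (a, b, c)"
  shows "E (s f) = s (quotient_rule dX f) * E a + s (quotient_rule dY f) * E b +
    s (quotient_rule dZ f) * E c"
proof -
  obtain p q where f: "f = Fract p q" and q: "q \<noteq> 0" by (cases f)
  note s' = rhomD[OF rhom_subst_rat[OF d], folded s_def]
  define t where "t = subst_poly (a, b, c)"
  have t: "s (to_fract r) = t r" for r by (simp add: s_def t_def subst_rat_to_fract)
  have fq: "f * to_fract q = to_fract p" using q by (simp add: f to_fract_def eq_fract)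
  have part: "s (quotient_rule D f) * t q + s f * t (D q) = t (D p)" if D: "derivation D" for D
  proof -
    have "quotient_rule D f * to_fract q + f * to_fract (D q) = to_fract (D p)"
      using arg_cong[OF fq, of "quotient_rule D"]
      by (simp add: derivationD[OF derivation_quotient_rule[OF D]] quotient_rule_to_fract[OF D])
    from arg_cong[OF this, of s] show ?thesis by (simp add: s' t)
  qed
  have "s f * t q = t p" using arg_cong[OF fq, of s] by (simp add: s' t)
  from arg_cong[OF this, of E] have "E (s f) * t q + s f * E (t q) = E (t p)"
    by (simp add: derivationD[OF E])
  then have "E (s f) * t q = (s (quotient_rule dX f) * E a + s (quotient_rule dY f) * E b +
      s (quotient_rule dZ f) * E c) * t q"
    using part[OF derivation_partial(1)] part[OF derivation_partial(2)]
      part[OF derivation_partial(3)] chain_rule_poly[OF E const, of a b c p, folded t_def]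
      chain_rule_poly[OF E const, of a b c q, folded t_def]
    by algebra
  moreover have "t q \<noteq> 0" using d q by (simp add: dominant_def t_def)
  ultimately show ?thesis by simp
qed

text \<open>The last clause, that pull-back commutes with \<open>diff\<close>, is the chain rule for
  the three partial derivatives.\<close>

lemma pullback_form_simps:
  assumes "dominant \<Phi>"
  shows "pullback_form \<Phi> (\<omega> + \<eta>) = pullback_form \<Phi> \<omega> + pullback_form \<Phi> \<eta>"
    "pullback_form \<Phi> (smul f \<omega>) = smul (subst_rat \<Phi> f) (pullback_form \<Phi> \<omega>)"
    "pullback_form \<Phi> 0 = 0"
    "pullback_form \<Phi> (diff f) = diff (subst_rat \<Phi> f)"
proof -
  obtain a b c where \<Phi>: "\<Phi> = (a, b, c)" by (cases \<Phi>)
  note s = rhomD[OF rhom_subst_rat[OF assms]]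
  show "pullback_form \<Phi> (\<omega> + \<eta>) = pullback_form \<Phi> \<omega> + pullback_form \<Phi> \<eta>"
    by (cases \<omega>; cases \<eta>) (simp add: \<Phi> pullback_form_def s[unfolded \<Phi>] smul_simps)
  show "pullback_form \<Phi> (smul f \<omega>) = smul (subst_rat \<Phi> f) (pullback_form \<Phi> \<omega>)"
    by (cases \<omega>) (simp add: \<Phi> pullback_form_def s[unfolded \<Phi>] smul_simps smul_def[of f])
  show "pullback_form \<Phi> 0 = 0"
    by (simp add: \<Phi> pullback_form_def zero_prod_def s[unfolded \<Phi>])
       (simp add: smul_simps zero_prod_def[symmetric])
  have "quotient_rule D (const_rat k) = 0" if "D \<in> {dX, dY, dZ}" for D k
    using diff_const[of k] that by (auto simp: diff_def zero_prod_def)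
  then show "pullback_form \<Phi> (diff f) = diff (subst_rat \<Phi> f)"
    using chain_rule_rat[OF assms[unfolded \<Phi>] derivation_quotient_rule]
    by (simp add: \<Phi> pullback_form_def diff_def smul_def derivation_partial)
qed

text \<open>For \<phi> = \<open>subst_rat \<Phi>\<close>, the action on forms required by
  \<open>birationally_equivalent\<close> is the pull-back of forms.\<close>

lemma pullback_form_sum:
  assumes "dominant \<Phi>"
  shows "form_sum (map (map_prod (subst_rat \<Phi>) (subst_rat \<Phi>)) xs) = pullback_form \<Phi> (form_sum xs)"
  by (induction xs) (auto simp: form_sum_def pullback_form_simps[OF assms])

lemma forms_on_image:
  assumes "dominant \<Phi>"
  shows "forms_on (subst_rat \<Phi> ` K) = pullback_form \<Phi> ` forms_on K"
proof -
  have "{xs. set xs \<subseteq> subst_rat \<Phi> ` K \<times> subst_rat \<Phi> ` K} =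
      map (map_prod (subst_rat \<Phi>) (subst_rat \<Phi>)) ` {xs. set xs \<subseteq> K \<times> K}"
    using lists_image[of "map_prod (subst_rat \<Phi>) (subst_rat \<Phi>)" "K \<times> K"]
    by (simp add: lists_eq_set map_prod_surj_on)
  then show ?thesis
    by (simp add: forms_on_def image_image pullback_form_sum[OF assms])
qed

lemma pullback_form_eq_0:
  assumes J: "jacobian \<Phi> \<noteq> 0"
  shows "pullback_form \<Phi> \<eta> = 0 \<longleftrightarrow> \<eta> = 0"
proof -
  obtain a b c A B C where \<Phi>: "\<Phi> = (a, b, c)" and \<eta>: "\<eta> = (A, B, C)" by (cases \<Phi>; cases \<eta>)
  note d = dominant_jacobian[OF J]
  show ?thesis
    using diff_independent[OF J[unfolded \<Phi>]] pullback_form_simps(3)[OF d]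
      rhom_divide(1)[OF rhom_subst_rat[OF d]]
    by (auto simp: pullback_form_def \<Phi> \<eta> zero_prod_def)
qed

text \<open>The factor \<open>k\<close> ranges over all of C(X,Y,Z), so the converse must show that
  the factor between the two pull-backs comes from a rational function before substitution.\<close>

lemma pullback_form_proportional:
  assumes J: "jacobian \<Phi> \<noteq> 0" and pb: "pullback_form \<Phi> \<omega> = smul h \<omega>'" "h \<noteq> 0" and \<omega>: "\<omega> \<noteq> 0"
  shows "(\<exists>k. pullback_form \<Phi> \<eta> = smul k \<omega>') \<longleftrightarrow> (\<exists>k. \<eta> = smul k \<omega>)"
proof
  note d = dominant_jacobian[OF J]
  note s = rhomD[OF rhom_subst_rat[OF d]]
  note sd = rhom_divide[OF rhom_subst_rat[OF d]]
  show "\<exists>k. pullback_form \<Phi> \<eta> = smul k \<omega>'" if "\<exists>k. \<eta> = smul k \<omega>"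
    using that by (auto simp: pullback_form_simps[OF d] pb smul_simps)
  assume "\<exists>k. pullback_form \<Phi> \<eta> = smul k \<omega>'"
  then obtain k where k: "pullback_form \<Phi> \<eta> = smul k \<omega>'" by blast
  obtain a b c where \<Phi>: "\<Phi> = (a, b, c)" by (cases \<Phi>)
  obtain e1 e2 e3 where \<eta>: "\<eta> = (e1, e2, e3)" by (cases \<eta>)
  obtain w1 w2 w3 where w: "\<omega> = (w1, w2, w3)" by (cases \<omega>)
  let ?s = "subst_rat \<Phi>"
  define m where "m = k / h"
  have "pullback_form \<Phi> \<eta> = smul m (pullback_form \<Phi> \<omega>)"
    using pb by (simp add: k m_def smul_simps)
  \<comment> \<open>The differentials of the components of \<Phi> are linearly independent, so
    coefficients can be compared.\<close>
  then have "smul (?s e1 - m * ?s w1) (diff a) + smul (?s e2 - m * ?s w2) (diff b) +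
      smul (?s e3 - m * ?s w3) (diff c) = 0"
    by (cases "diff a"; cases "diff b"; cases "diff c")
       (auto simp: pullback_form_def \<Phi> \<eta> w smul_def zero_prod_def algebra_simps)
  from diff_independent[OF J[unfolded \<Phi>] this]
  have e: "?s e1 = m * ?s w1" "?s e2 = m * ?s w2" "?s e3 = m * ?s w3" by auto
  \<comment> \<open>At a nonzero coefficient of \<omega> the factor is a quotient of two substituted
    functions, hence itself substituted.\<close>
  obtain g where "m = ?s g"
  proof -
    consider "w1 \<noteq> 0" | "w2 \<noteq> 0" | "w3 \<noteq> 0" using \<omega> w by (auto simp: zero_prod_def)
    then have "m = ?s (e1 / w1) \<or> m = ?s (e2 / w2) \<or> m = ?s (e3 / w3)"
      by cases (simp_all add: sd e)
    then show ?thesis using that by blast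
  qed
  then have "?s e1 = ?s (g * w1)" "?s e2 = ?s (g * w2)" "?s e3 = ?s (g * w3)"
    by (simp_all add: e s)
  then have "\<eta> = smul g \<omega>" using injD[OF sd(2)] by (simp add: \<eta> w smul_def)
  then show "\<exists>k. \<eta> = smul k \<omega>" ..
qed

text \<open>A field homomorphism fixing the constants is injective, so it both preserves and
  reflects polynomial relations; the image of a transcendence basis works.\<close>

lemma transcendence_degree_image:
  assumes d: "dominant \<Phi>" and K: "transcendence_degree_2 K"
  shows "transcendence_degree_2 (subst_rat \<Phi> ` K)"
proof -
  note h = rhom_subst_rat[OF d]
  obtain f g where fg: "f \<in> K" "g \<in> K" "\<And>r. r \<noteq> 0 \<Longrightarrow> subst_poly (f, g, 0) [:r:] \<noteq> 0"
    "\<And>h. h \<in> K \<Longrightarrow> \<exists>p. p \<noteq> 0 \<and> subst_poly (f, g, h) p = 0"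
    using K unfolding transcendence_degree_2_def by blast
  have comp: "subst_poly (subst_rat \<Phi> x, subst_rat \<Phi> y, subst_rat \<Phi> z) p =
      subst_rat \<Phi> (subst_poly (x, y, z) p)" for x y z p
    using subst_poly_comp[OF h subst_rat_const] by simp
  show ?thesis
    unfolding transcendence_degree_2_def
  proof (intro bexI conjI allI impI ballI)
    fix r :: "complex poly poly" assume "r \<noteq> 0"
    then show "subst_poly (subst_rat \<Phi> f, subst_rat \<Phi> g, 0) [:r:] \<noteq> 0"
      using fg(3) comp[of f g 0] by (simp add: rhomD[OF h] rhom_divide[OF h])
  next
    fix k assume "k \<in> subst_rat \<Phi> ` K"
    then obtain k' where k: "k' \<in> K" "k = subst_rat \<Phi> k'" by blast
    show "\<exists>p. p \<noteq> 0 \<and> subst_poly (subst_rat \<Phi> f, subst_rat \<Phi> g, k) p = 0"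
      using fg(4)[OF k(1)] by (auto simp: k(2) comp rhomD[OF h])
  qed (use fg in auto)
qed

text \<open>The isomorphism is \<open>subst_rat \<Phi>\<close> from \<open>K\<close> onto its image.
  Proportionality transfers in both directions, so it carries the foliation on \<open>K\<close>, and
  a generator of it, to the one on the image.\<close>

lemma birationally_equivalent_pullback:
  assumes J: "jacobian \<Phi> \<noteq> 0"
    and surf: "is_foliated_surface (K, induced_foliation K \<omega>)"
    and pb: "pullback_form \<Phi> (rat_form \<omega>) = smul h (rat_form \<omega>')" "h \<noteq> 0" "rat_form \<omega> \<noteq> 0"
  shows "birationally_equivalent
    (subst_rat \<Phi> ` K, induced_foliation (subst_rat \<Phi> ` K) \<omega>') (K, induced_foliation K \<omega>)"
proof -
  note d = dominant_jacobian[OF J]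
  note h = rhom_subst_rat[OF d]
  note proportional = pullback_form_proportional[OF J pb]
  have ind: "induced_foliation (subst_rat \<Phi> ` K) \<omega>' = pullback_form \<Phi> ` induced_foliation K \<omega>"
  proof -
    have "induced_foliation (subst_rat \<Phi> ` K) \<omega>' =
        pullback_form \<Phi> ` {\<eta> \<in> forms_on K. \<exists>k. pullback_form \<Phi> \<eta> = smul k (rat_form \<omega>')}"
      unfolding induced_foliation_def forms_on_image[OF d] by blast
    then show ?thesis by (simp add: proportional induced_foliation_def)
  qed
  have K: "function_field K" "transcendence_degree_2 K"
    using surf by (simp_all add: is_foliated_surface_def)
  obtain \<eta> where \<eta>: "\<eta> \<in> forms_on K" "\<eta> \<noteq> 0" "induced_foliation K \<omega> = {smul f \<eta> |f. f \<in> K}"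
    using surf by (auto simp: is_foliated_surface_def)
  have "induced_foliation (subst_rat \<Phi> ` K) \<omega>' =
      {smul f (pullback_form \<Phi> \<eta>) |f. f \<in> subst_rat \<Phi> ` K}"
    unfolding ind \<eta>(3) by (force simp: pullback_form_simps[OF d])
  moreover have "pullback_form \<Phi> \<eta> \<in> forms_on (subst_rat \<Phi> ` K)" "pullback_form \<Phi> \<eta> \<noteq> 0"
    using \<eta> by (simp_all add: forms_on_image[OF d] pullback_form_eq_0[OF J])
  ultimately have "is_foliated_surface (subst_rat \<Phi> ` K, induced_foliation (subst_rat \<Phi> ` K) \<omega>')"
    unfolding is_foliated_surface_def
    using function_field_image[OF K(1) h subst_rat_const] transcendence_degree_image[OF d K(2)]
    by auto
  moreover have "birational_map (subst_rat \<Phi> ` K) K (subst_rat \<Phi>)"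
    using rhom_divide(2)[OF h]
    by (auto simp: birational_map_def bij_betw_def rhomD[OF h] subst_rat_const intro: inj_on_subset)
  moreover have "form_sum (map (map_prod (subst_rat \<Phi>) (subst_rat \<Phi>)) xs)
        \<in> induced_foliation (subst_rat \<Phi> ` K) \<omega>' \<longleftrightarrow> form_sum xs \<in> induced_foliation K \<omega>"
    if "set xs \<subseteq> K \<times> K" for xs
  proof -
    have "form_sum xs \<in> forms_on K" using that by (simp add: forms_on_def)
    then show ?thesis
      unfolding induced_foliation_def mem_Collect_eq pullback_form_sum[OF d] forms_on_image[OF d]
      using proportional by blast
  qed
  ultimately show ?thesis
    using surf by (auto simp: birationally_equivalent_def)
qed

section \<open>The plane as a foliated surface\<close>

lemma quotient_rule_divide:
  assumes "derivation D" "q \<noteq> 0"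
  shows "quotient_rule D (to_fract p / to_fract q) =
    (to_fract (D p) * to_fract q - to_fract p * to_fract (D q)) / to_fract q ^ 2"
  using quotient_rule_Fract[OF assms, of p]
  by (simp add: Fract_conv_to_fract rhomD(7)[OF rhom_to_fract])

lemma diff_affine:
  "diff (to_fract varX / to_fract varZ) = (1 / to_fract varZ, 0, - to_fract varX / to_fract varZ ^ 2)"
  "diff (to_fract varY / to_fract varZ) = (0, 1 / to_fract varZ, - to_fract varY / to_fract varZ ^ 2)"
  "diff (to_fract varZ) = (0, 0, 1)"
proof -
  have "varZ \<noteq> 0" by (simp add: varZ_def)
  then show "diff (to_fract varX / to_fract varZ) = (1 / to_fract varZ, 0, - to_fract varX / to_fract varZ ^ 2)"
    "diff (to_fract varY / to_fract varZ) = (0, 1 / to_fract varZ, - to_fract varY / to_fract varZ ^ 2)"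
    "diff (to_fract varZ) = (0, 0, 1)"
    by (simp_all add: diff_def quotient_rule_divide derivation_partial partial_var
        quotient_rule_to_fract power2_eq_square)
qed

lemma transcendence_degree_P2: "transcendence_degree_2 P2_functions"
proof -
  let ?x = "to_fract varX" and ?y = "to_fract varY" and ?z = "to_fract varZ"
  have z: "?z \<noteq> 0" by (simp add: varZ_def)
  \<comment> \<open>Z completes the affine coordinates to a triple with Jacobian 1/Z^2. A polynomial
    \<open>[:r:]\<close> does not contain the third variable, so Z may then be replaced by any
    \<open>c\<close>.\<close>
  have "jacobian (?x / ?z, ?y / ?z, ?z) \<noteq> 0"
    using z by (simp add: jacobian_def diff_affine)
  from dominant_jacobian[OF this]
  have dom: "subst_poly (?x / ?z, ?y / ?z, c) [:r:] \<noteq> 0" if "r \<noteq> 0" for r c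
    using that by (simp add: dominant_def) (metis pCons_eq_0_iff rhomD(3)[OF rhom_subst_poly]
        mult_zero_right subst_poly_pCons)
  have "\<exists>p. p \<noteq> 0 \<and> subst_poly (?x / ?z, ?y / ?z, h) p = 0" if "h \<in> P2_functions" for h
  proof -
    obtain p q d where h: "h = Fract p q" "q \<noteq> 0" "homogeneous d p" "homogeneous d q"
      using \<open>h \<in> P2_functions\<close> by (auto simp: P2_functions_def)
    have ev: "sub2 (?x / ?z) (?y / ?z) (poly r 1) = to_fract r / ?z ^ d" if "homogeneous d r" for r
    proof -
      have "sub2 (?x / ?z) (?y / ?z) (poly r 1) = subst_poly (?x / ?z, ?y / ?z, 1) r" for r
        by (induction r) (simp_all add: rhomD[OF rhom_sub2] subst_poly_pCons rhomD[OF rhom_subst_poly])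
      then show ?thesis using to_fract_homogeneous[OF that] by simp
    qed
    have "sub2 (?x / ?z) (?y / ?z) (poly q 1) \<noteq> 0" using h z by (simp add: ev)
    \<comment> \<open>Setting Z = 1 in numerator and denominator gives a relation for
      \<open>h\<close> that is linear in the third variable.\<close>
    then have "[:- poly p 1, poly q 1:] \<noteq> 0" by (auto simp: rhomD[OF rhom_sub2])
    moreover have "subst_poly (?x / ?z, ?y / ?z, h) [:- poly p 1, poly q 1:] = 0"
      using h z by (simp add: subst_poly_pCons ev rhomD[OF rhom_sub2] rhomD[OF rhom_subst_poly]
          Fract_conv_to_fract)
    ultimately show ?thesis by blast
  qed
  moreover have "?x / ?z \<in> P2_functions" "?y / ?z \<in> P2_functions"
    using P2_functions_quotient[of 1] homogeneous_atoms(2,3) by fastforce+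
  ultimately show ?thesis
    unfolding transcendence_degree_2_def using dom by blast
qed

text \<open>The dX-coefficient of a form on the plane has degree -1. This is used to show that
  proportionality factors lie in the function field.\<close>

lemma forms_on_P2:
  assumes "(a, b, c) \<in> forms_on P2_functions"
  shows "to_fract varZ * a \<in> P2_functions"
proof -
  note K = function_fieldD[OF function_field_P2]
  have "to_fract varZ * fst (form_sum xs) \<in> P2_functions" if "set xs \<subseteq> P2_functions \<times> P2_functions" for xs
    using that
  proof (induction xs)
    case (Cons x xs)
    obtain f g where x: "x = (f, g)" by (cases x)
    have "f * (to_fract varZ * quotient_rule dX g) \<in> P2_functions"
      using Cons.prems P2_functions_partial[of g dX] by (auto simp: x intro: K(8))
    moreover have "to_fract varZ * fst (form_sum xs) \<in> P2_functions"
      using Cons by simp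
    ultimately have "f * (to_fract varZ * quotient_rule dX g) + to_fract varZ * fst (form_sum xs)
      \<in> P2_functions" by (rule K(6))
    then show ?case
      by (simp add: x form_sum_def diff_def smul_def algebra_simps)
  qed (simp add: form_sum_def K)
  moreover obtain xs where "set xs \<subseteq> P2_functions \<times> P2_functions" "(a, b, c) = form_sum xs"
    using assms by (auto simp: forms_on_def)
  ultimately show ?thesis by (metis fst_conv)
qed

lemma foliated_surface_P2:
  assumes fol: "P2_foliation d (A, B, C)" and "A \<noteq> 0"
  shows "is_foliated_surface (foliated_P2 (A, B, C))"
proof -
  note K = function_fieldD[OF function_field_P2]
  let ?x = "to_fract varX" and ?y = "to_fract varY" and ?z = "to_fract varZ"
  have z: "?z \<noteq> 0" by (simp add: varZ_def)
  \<comment> \<open>The coefficients have degree \<open>d + 1\<close> and each differential adds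
    one, so Z^(\<open>d\<close> + 2) makes the form homogeneous of degree 0.\<close>
  define \<eta> where "\<eta> = smul (1 / ?z ^ (d + 2)) (rat_form (A, B, C))"
  have "homogeneous (d + 1) A" "homogeneous (d + 1) B"
    using fol by (simp_all add: P2_foliation_def)
  from this[THEN P2_functions_quotient]
  have AB: "to_fract A / ?z ^ (d + 1) \<in> P2_functions" "to_fract B / ?z ^ (d + 1) \<in> P2_functions" .
  have xy: "?x / ?z \<in> P2_functions" "?y / ?z \<in> P2_functions"
    using P2_functions_quotient[of 1] homogeneous_atoms(2,3) by fastforce+
  have "to_fract (varX * A + varY * B + varZ * C) = 0"
    using fol by (simp add: P2_foliation_def)
  then have "?x * to_fract A + ?y * to_fract B + ?z * to_fract C = 0" by simp
  then have C: "to_fract C = - (?x * to_fract A + ?y * to_fract B) / ?z"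
    using z by (simp add: field_simps eq_neg_iff_add_eq_0)
  \<comment> \<open>Eliminating \<open>C\<close> by the Euler relation expresses the form in d(X/Z)
    and d(Y/Z).\<close>
  have mult: "smul f \<eta> = form_sum [(f * (to_fract A / ?z ^ (d + 1)), ?x / ?z),
      (f * (to_fract B / ?z ^ (d + 1)), ?y / ?z)]" for f
    using z by (simp add: \<eta>_def form_sum_def diff_affine smul_def rat_form_def C zero_prod_def
        field_simps power2_eq_square)
  have mem: "smul f \<eta> \<in> forms_on P2_functions" if "f \<in> P2_functions" for f
    unfolding mult forms_on_def using xy K(8)[OF that AB(1)] K(8)[OF that AB(2)] by (intro imageI) simp
  have "induced_foliation P2_functions (A, B, C) = {smul f \<eta> |f. f \<in> P2_functions}"
  proof (intro equalityI subsetI)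
    fix \<theta> assume "\<theta> \<in> {smul f \<eta> |f. f \<in> P2_functions}"
    then show "\<theta> \<in> induced_foliation P2_functions (A, B, C)"
      using mem by (auto simp: induced_foliation_def \<eta>_def smul_simps)
  next
    fix \<theta> assume "\<theta> \<in> induced_foliation P2_functions (A, B, C)"
    then obtain g where \<theta>: "\<theta> \<in> forms_on P2_functions" "\<theta> = smul g (rat_form (A, B, C))"
      by (auto simp: induced_foliation_def)
    then have "?z * (g * to_fract A) \<in> P2_functions"
      using forms_on_P2[of "g * to_fract A"] by (simp add: rat_form_def smul_def)
    \<comment> \<open>Dividing the dX-coefficient by the nonzero A/Z^(\<open>d\<close> + 1) isolates
      the multiplier of \<eta>.\<close>
    from K(9)[OF this AB(1)] have "g * ?z ^ (d + 2) \<in> P2_functions"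
      using z \<open>A \<noteq> 0\<close> by (simp add: field_simps)
    moreover have "\<theta> = smul (g * ?z ^ (d + 2)) \<eta>"
      using z by (simp add: \<theta> \<eta>_def smul_simps)
    ultimately show "\<theta> \<in> {smul f \<eta> |f. f \<in> P2_functions}" by blast
  qed
  moreover have "\<eta> \<in> forms_on P2_functions" using mem[OF K(3)] by (simp add: smul_simps)
  moreover have "\<eta> \<noteq> 0"
    using z \<open>A \<noteq> 0\<close> by (simp add: \<eta>_def smul_def rat_form_def zero_prod_def)
  ultimately show ?thesis
    using function_field_P2 transcendence_degree_P2
    by (auto simp: is_foliated_surface_def foliated_P2_def)
qed

section \<open>Common factors of products of linear forms\<close>

text \<open>Eliminating the variable leaves a nonzero constant divisible by \<open>p\<close>. So
  \<open>p\<close> is constant, and it divides the unit leading coefficient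
  \<open>a\<close>.\<close>

lemma is_unit_common_divisor_linear:
  fixes p :: "'a::{idom_divide, algebraic_semidom} poly"
  assumes "p dvd [:u, a:]" "p dvd [:v, b:]" "is_unit a" "a * v \<noteq> b * u"
  shows "is_unit p"
proof -
  have "p dvd smult a [:v, b:] - smult b [:u, a:]"
    using assms by (intro dvd_diff dvd_smult)
  then have "p dvd [:a * v - b * u:]" by (simp add: algebra_simps)
  then have "degree p = 0"
    using assms(4) dvd_imp_degree_le[of p "[:a * v - b * u:]"] by simp
  then obtain c where c: "p = [:c:]" by (metis degree_eq_zeroE)
  then have "c dvd a" using assms(1) by (auto simp: const_poly_dvd_iff coeff_pCons dest: spec[of _ "Suc 0"])
  then show ?thesis using assms(3) c by (metis dvd_trans is_unit_const_poly_iff)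
qed

definition linear_form :: "complex \<Rightarrow> complex \<Rightarrow> complex \<Rightarrow> poly3" where
  "linear_form a b c = const3 a * varX + const3 b * varY + const3 c * varZ"

lemma linear_form_pCons: "linear_form a b c = [:[:[:0, a:], [:b:]:], [:[:c:]:]:]"
  by (simp add: linear_form_def const3_def varX_def varY_def varZ_def)

lemma is_unit_common_divisor_linear_forms:
  assumes dvd: "p dvd linear_form a b c" "p dvd linear_form a' b' c'"
    and ind: "a * b' \<noteq> a' * b \<or> a * c' \<noteq> a' * c \<or> b * c' \<noteq> b' * c"
  shows "is_unit p"
proof -
  have *: "is_unit p" if "p dvd linear_form a b c" "p dvd linear_form a' b' c'" "c \<noteq> 0"
    "a * b' \<noteq> a' * b \<or> a * c' \<noteq> a' * c \<or> b * c' \<noteq> b' * c" for a b c a' b' c'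
  proof (rule is_unit_common_divisor_linear)
    show "p dvd [:[:[:0, a:], [:b:]:], [:[:c:]:]:]" "p dvd [:[:[:0, a':], [:b':]:], [:[:c':]:]:]"
      using that by (simp_all only: linear_form_pCons)
    show "is_unit [:[:c:]:]" using \<open>c \<noteq> 0\<close> by (simp add: is_unit_const_poly_iff dvd_field_iff)
    \<comment> \<open>For \<open>c \<noteq> 0\<close> the minor without \<open>c\<close> vanishes as
      soon as the other two do.\<close>
    have "c * a' \<noteq> c' * a \<or> c * b' \<noteq> c' * b"
    proof (rule ccontr)
      assume "\<not> ?thesis"
      then have eq: "c * a' = c' * a" "c * b' = c' * b" by auto
      then have "c * (a * b' - a' * b) = 0" by algebra
      then show False using that(3,4) eq by (simp add: mult.commute)
    qed
    then show "[:[:c:]:] * [:[:0, a':], [:b':]:] \<noteq> [:[:c':]:] * [:[:0, a:], [:b:]:]" by auto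
  qed
  show ?thesis
  proof (cases "c = 0 \<and> c' = 0")
    case False
    then show ?thesis using *[OF dvd] *[OF dvd(2,1)] ind by (metis mult.commute)
  next
    case True
    \<comment> \<open>Neither form contains Z, so the elimination is carried out one layer down, in
      Y.\<close>
    then have ab: "a * b' \<noteq> a' * b" using ind by simp
    then have nz: "[:[:0, a:], [:b:]:] \<noteq> 0" by auto
    have "degree p = 0"
      using dvd(1) nz True dvd_imp_degree_le[of p "[:[:[:0, a:], [:b:]:]:]"]
      by (simp add: linear_form_pCons)
    then obtain q where q: "p = [:q:]" by (metis degree_eq_zeroE)
    then have "q dvd [:[:0, a:], [:b:]:]" "q dvd [:[:0, a':], [:b':]:]"
      using dvd True by (simp_all add: linear_form_pCons)
    moreover have "b \<noteq> 0 \<or> b' \<noteq> 0" using ab by auto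
    ultimately have "is_unit q"
      using is_unit_common_divisor_linear[of q "[:0, a:]" "[:b:]" "[:0, a':]" "[:b':]"]
        is_unit_common_divisor_linear[of q "[:0, a':]" "[:b':]" "[:0, a:]" "[:b:]"] ab
      by (auto simp: is_unit_const_poly_iff dvd_field_iff mult.commute)
    then show ?thesis by (simp add: q is_unit_const_poly_iff)
  qed
qed

lemma linear_form_var: "varX = linear_form 1 0 0" "varY = linear_form 0 1 0" "varZ = linear_form 0 0 1"
  by (simp_all add: linear_form_def rhomD[OF rhom_const3])

lemma homogeneous_linear_form: "homogeneous (Suc 0) (linear_form a b c)"
  using homogeneous_mult[OF homogeneous_atoms(1,2)] homogeneous_mult[OF homogeneous_atoms(1,3)]
    homogeneous_mult[OF homogeneous_atoms(1,4)]
  by (simp add: linear_form_def homogeneous_add)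

text \<open>By factoriality a nonzero non-unit has a prime divisor; \<open>A \<noteq> 0\<close>
  excludes the zero divisor.\<close>

lemma no_common_factorI:
  fixes A B C :: poly3
  assumes "A \<noteq> 0" and "\<And>p. prime p \<Longrightarrow> p dvd A \<Longrightarrow> p dvd B \<Longrightarrow> p dvd C \<Longrightarrow> is_unit p"
  shows "\<forall>h. h dvd A \<and> h dvd B \<and> h dvd C \<longrightarrow> is_unit h"
proof (intro allI impI, rule ccontr)
  fix h assume h: "h dvd A \<and> h dvd B \<and> h dvd C" "\<not> is_unit h"
  then have "h \<noteq> 0" using assms(1) by auto
  then obtain p where "p dvd h" "prime p" using h(2) prime_divisor_exists by blast
  then show False using assms(2)[of p] h(1) by (meson dvd_trans not_prime_unit)
qed

section \<open>Degrees and coprimality of the two given forms\<close>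

lemma const3_eq_0: "const3 c = 0 \<longleftrightarrow> c = 0"
  by (simp add: const3_def)

lemma const3_dvd_1: "c \<noteq> 0 \<Longrightarrow> is_unit (const3 c)"
  by (simp add: const3_def is_unit_const_poly_iff dvd_field_iff)

text \<open>A prime common divisor divides one coordinate out of each of the three pairs, hence two
  different coordinates. The hypotheses on \<open>l\<close> make the constant factors units.\<close>

lemma P2_foliation_F:
  assumes "l \<noteq> 0" "l \<noteq> 1"
  shows "P2_foliation 1 (F_foliation l)"
proof -
  let ?A = "const3 l * varY * varZ" and ?B = "- (varX * varZ)" and ?C = "const3 (1 - l) * varX * varY"
  have var: "homogeneous 2 (varX * varY)" "homogeneous 2 (varX * varZ)" "homogeneous 2 (varY * varZ)"
    using homogeneous_mult[OF homogeneous_atoms(2,3)] homogeneous_mult[OF homogeneous_atoms(2,4)]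
      homogeneous_mult[OF homogeneous_atoms(3,4)] by (simp_all add: numeral_2_eq_2)
  have hom: "homogeneous 2 ?A" "homogeneous 2 ?B" "homogeneous 2 ?C"
    using homogeneous_mult[OF homogeneous_atoms(1) var(3)] homogeneous_uminus[OF var(2)]
      homogeneous_mult[OF homogeneous_atoms(1) var(1)] by (simp_all add: mult.assoc numeral_2_eq_2)
  have "\<forall>h. h dvd ?A \<and> h dvd ?B \<and> h dvd ?C \<longrightarrow> is_unit h"
  proof (rule no_common_factorI)
    show "?A \<noteq> 0" using assms by (simp add: const3_eq_0 varY_def varZ_def)
    fix p :: poly3
    assume p: "prime p" and dvd: "p dvd ?A" "p dvd ?B" "p dvd ?C"
    have "\<not> p dvd const3 l" "\<not> p dvd const3 (1 - l)"
      using const3_dvd_1[of l] const3_dvd_1[of "1 - l"] assms p by (metis dvd_trans eq_iff_diff_eq_0 not_prime_unit)+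
    then have "p dvd varY \<or> p dvd varZ" "p dvd varX \<or> p dvd varZ" "p dvd varX \<or> p dvd varY"
      using dvd p by (auto simp: prime_dvd_mult_iff)
    then show "is_unit p"
      using is_unit_common_divisor_linear_forms[of p 1 0 0 0 1 0]
        is_unit_common_divisor_linear_forms[of p 1 0 0 0 0 1]
        is_unit_common_divisor_linear_forms[of p 0 1 0 0 0 1]
      by (auto simp: linear_form_var[symmetric])
  qed
  then show ?thesis
    using hom by (simp add: P2_foliation_def F_foliation_def numeral_2_eq_2 rhomD[OF rhom_const3]
        algebra_simps)
qed

text \<open>All factors are linear forms. A factor of \<open>A\<close> and a factor of
  \<open>B\<close> are never proportional except for the common Z, and Z is proportional to no
  factor of \<open>C\<close>.\<close>

lemma P2_foliation_G:
  assumes l: "l \<noteq> 0" "l \<noteq> 1"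
  shows "P2_foliation 3 (G_foliation l)"
proof -
  let ?L = "linear_form"
  define A where "A = ?L 0 1 0 * ?L 0 0 1 * ?L 0 1 1 * ?L (l + 1) 1 l"
  define B where "B = ?L 1 0 0 * ?L 0 0 1 * ?L 1 0 1 * ?L (l - 1) (2 * l - 1) l"
  define C where "C = ?L 1 0 0 * ?L 0 1 0 * ?L 1 1 0 * ?L (l - 1) (- 1) (l - 2)"
  have G: "G_foliation l = (A, - B, C)"
    by (simp add: G_foliation_def A_def B_def C_def linear_form_def rhomD[OF rhom_const3])
  have "homogeneous 4 (?L a b c * ?L a' b' c' * ?L a'' b'' c'' * ?L d e f)"
    for a b c a' b' c' a'' b'' c'' d e f
    using homogeneous_mult[OF homogeneous_mult[OF homogeneous_mult[OF homogeneous_linear_form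
        homogeneous_linear_form] homogeneous_linear_form] homogeneous_linear_form]
    by (simp add: eval_nat_numeral)
  then have hom: "homogeneous 4 A" "homogeneous 4 B" "homogeneous 4 C"
    by (simp_all add: A_def B_def C_def)
  have "\<forall>h. h dvd A \<and> h dvd - B \<and> h dvd C \<longrightarrow> is_unit h"
  proof (rule no_common_factorI)
    show "A \<noteq> 0" by (simp add: A_def linear_form_pCons)
    fix p :: poly3
    assume p: "prime p" and dvd: "p dvd A" "p dvd - B" "p dvd C"
    note unit = is_unit_common_divisor_linear_forms[of p]
    consider "p dvd ?L 0 1 0" | "p dvd ?L 0 0 1" | "p dvd ?L 0 1 1" | "p dvd ?L (l + 1) 1 l"
      using dvd(1) p by (auto simp: A_def prime_dvd_mult_iff)
    note A = this
    consider "p dvd ?L 1 0 0" | "p dvd ?L 0 0 1" | "p dvd ?L 1 0 1" | "p dvd ?L (l - 1) (2 * l - 1) l"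
      using dvd(2) p by (auto simp: B_def prime_dvd_mult_iff)
    note B = this
    consider "p dvd ?L 1 0 0" | "p dvd ?L 0 1 0" | "p dvd ?L 1 1 0" | "p dvd ?L (l - 1) (- 1) (l - 2)"
      using dvd(3) p by (auto simp: C_def prime_dvd_mult_iff)
    note C = this
    have z: "is_unit p" if "p dvd ?L 0 0 1"
      using C by cases (rule unit[OF that], assumption, simp)+
    \<comment> \<open>This minor of the two factors depending on \<open>l\<close> has value 2
      \<open>l\<close>^2.\<close>
    have "(l + 1) * (2 * l - 1) \<noteq> (l - 1) * 1"
    proof
      assume "(l + 1) * (2 * l - 1) = (l - 1) * 1"
      then have "2 * (l * l) = 0" by (simp add: algebra_simps)
      then show False using l by simp
    qed
    with l show "is_unit p"
      by (cases rule: A; cases rule: B) (auto intro: z unit)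
  qed
  moreover have "varX * A + varY * - B + varZ * C = 0"
    by (simp add: A_def B_def C_def linear_form_def rhomD[OF rhom_const3] rhom_numeral[OF rhom_const3] algebra_simps)
  ultimately show ?thesis
    using hom by (simp add: G P2_foliation_def homogeneous_uminus)
qed

section \<open>The quotient by the Cremona involution\<close>

lemma diff_to_fract: "diff (to_fract p) = (to_fract (dX p), to_fract (dY p), to_fract (dZ p))"
  by (simp add: diff_def quotient_rule_to_fract derivation_partial)

lemmas partial_simps = derivationD[OF derivation_partial(1)] derivationD[OF derivation_partial(2)]
  derivationD[OF derivation_partial(3)] partial_var

lemma jacobian_to_fract:
  "jacobian (to_fract a, to_fract b, to_fract c) = to_fract
    (dX a * (dY b * dZ c - dZ b * dY c) - dY a * (dX b * dZ c - dZ b * dX c)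
      + dZ a * (dX b * dY c - dY b * dX c))"
  by (simp add: jacobian_def diff_to_fract)

lemma pullback_form_to_fract:
  fixes a b c :: poly3
  defines "\<Phi> \<equiv> (to_fract a, to_fract b, to_fract c)"
  shows "pullback_form \<Phi> (rat_form (A, B, C)) = smul (subst_poly \<Phi> A) (rat_form (dX a, dY a, dZ a)) +
    smul (subst_poly \<Phi> B) (rat_form (dX b, dY b, dZ b)) + smul (subst_poly \<Phi> C) (rat_form (dX c, dY c, dZ c))"
  by (simp add: \<Phi>_def pullback_form_def rat_form_def diff_to_fract subst_rat_to_fract)

lemma dominant_cremona: "dominant cremona"
proof (rule dominant_jacobian)
  have "jacobian cremona = to_fract (2 * varX * varY * varZ)"
    unfolding cremona_def jacobian_to_fract by (simp only: partial_simps) (simp add: algebra_simps)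
  moreover have "2 * varX * varY * varZ \<noteq> 0" by (simp add: varX_def varY_def varZ_def)
  ultimately show "jacobian cremona \<noteq> 0" by (simp only: to_fract_eq_0_iff not_False_eq_True)
qed

text \<open>Divided by XYZ the form is \<open>l\<close> dX/X - dY/Y + (1 - \<open>l\<close>) dZ/Z.
  Since YZ = XYZ/X, the involution negates each logarithmic differential up to the common term
  d(XYZ)/(XYZ), which cancels because the residues sum to 0. As XYZ pulls back to its square, the
  factor is -XYZ.\<close>

lemma preserves_F: "preserves_foliation cremona (F_foliation l)"
proof -
  have "pullback_form cremona (rat_form (F_foliation l)) =
      smul (- to_fract (varX * varY * varZ)) (rat_form (F_foliation l))"
    unfolding cremona_def F_foliation_def pullback_form_to_fract
    by (simp add: rat_form_def rhomD[OF rhom_subst_poly] subst_poly_simps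
        partial_simps smul_def const_rat_def[symmetric] rhomD[OF rhom_const_rat]
        rhomD[OF rhom_const3] algebra_simps)
  moreover have "- to_fract (varX * varY * varZ) \<noteq> 0" by (simp add: varX_def varY_def varZ_def)
  ultimately show ?thesis unfolding preserves_foliation_def by blast
qed

text \<open>
  The quotient of the sextic del Pezzo surface by \<open>Q\<close> is Cayley's four-nodal cubic. Blowing down
  the strict transforms of the six lines \<open>X = \<plusminus>Y\<close>, \<open>Y = \<plusminus>Z\<close>, \<open>X = \<plusminus>Z\<close> that join the fixed points
  of \<open>Q\<close> leads to a plane in which the four nodes become the sides \<open>x = 0\<close>, \<open>y = 0\<close>, \<open>z = 0\<close>,
  \<open>x + y + z = 0\<close> of a complete quadrilateral. Each side pulls back to the three lines through the
  corresponding fixed point; this determines the cubics below up to constants.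
\<close>
definition quotX :: poly3 where "quotX = (varX - varY) * (varX + varZ) * (varY + varZ)"
definition quotY :: poly3 where "quotY = - ((varX + varY) * (varX - varZ) * (varY + varZ))"
definition quotZ :: poly3 where "quotZ = (varX + varY) * (varX + varZ) * (varY - varZ)"

definition quotient_map :: "ratfun \<times> ratfun \<times> ratfun" where
  "quotient_map = (to_fract quotX, to_fract quotY, to_fract quotZ)"

lemma var_nonzero:
  "varX \<noteq> 0" "varY \<noteq> 0" "varZ \<noteq> 0" "varX - varY \<noteq> 0" "varX + varY \<noteq> 0"
  "varX - varZ \<noteq> 0" "varX + varZ \<noteq> 0"
  "varY - varZ \<noteq> 0" "varY + varZ \<noteq> 0"
  by (simp_all add: varX_def varY_def varZ_def one_pCons)

text \<open>The determinant has degree six and vanishes along the six contracted lines, so it is a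
  constant multiple of their product.\<close>

lemma jacobian_quotient_map: "jacobian quotient_map \<noteq> 0"
proof -
  have "jacobian quotient_map = to_fract (12 * (varX - varY) * (varX + varY) * (varY - varZ) *
      (varY + varZ) * (varX - varZ) * (varX + varZ))"
    unfolding quotient_map_def jacobian_to_fract to_fract_eq_iff quotX_def quotY_def quotZ_def
    by (simp only: partial_simps) algebra
  moreover have "(12 * (varX - varY) * (varX + varY) * (varY - varZ) * (varY + varZ) * (varX - varZ) *
      (varX + varZ)) \<noteq> 0"
    using var_nonzero by simp
  ultimately show ?thesis by (simp only: to_fract_eq_0_iff not_False_eq_True)
qed

text \<open>The last three linear factors multiply to \<open>quotX + quotY + quotZ\<close>, so the
  cofactor is -8 times the product of the pull-backs of the four sides x, y, z, x + y + z.\<close>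

lemma pullback_G:
  "pullback_form quotient_map (rat_form (G_foliation l)) =
     smul (to_fract (- 8 * quotX * quotY * quotZ * ((varX - varY) * (varX - varZ) * (varY - varZ))))
       (rat_form (F_foliation l))"
  unfolding quotient_map_def G_foliation_def F_foliation_def pullback_form_to_fract
  by (simp only: rat_form_def smul_def prod.case plus_prod_def fst_conv snd_conv prod.inject
      rhomD[OF rhom_subst_poly] subst_poly_simps rhomD[OF rhom_const_rat] rhomD[OF rhom_const3]
      rhom_numeral[OF rhom_const_rat] partial_simps quotX_def quotY_def quotZ_def rhomD[OF rhom_to_fract]
      rhom_numeral[OF rhom_to_fract] const_rat_def[symmetric])
    (intro conjI; algebra)

lemma homogeneous_quot: "homogeneous 3 quotX" "homogeneous 3 quotY" "homogeneous 3 quotZ"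
proof -
  note h = homogeneous_mult[OF homogeneous_mult]
  have linear: "homogeneous (Suc 0) (varX - varY)" "homogeneous (Suc 0) (varX + varY)"
    "homogeneous (Suc 0) (varX - varZ)" "homogeneous (Suc 0) (varY - varZ)"
    "homogeneous (Suc 0) (varX + varZ)" "homogeneous (Suc 0) (varY + varZ)"
    by (intro homogeneous_add homogeneous_diff homogeneous_atoms)+
  show "homogeneous 3 quotX" "homogeneous 3 quotY" "homogeneous 3 quotZ"
    using h[OF linear(1,5,6)] homogeneous_uminus[OF h[OF linear(2,3,6)]] h[OF linear(2,5,4)]
    by (simp_all add: quotX_def quotY_def quotZ_def numeral_3_eq_3)
qed

lemma cremona_quot:
  "subst_rat cremona (to_fract quotX) = - to_fract (varX * varY * varZ) * to_fract quotX"
  "subst_rat cremona (to_fract quotY) = - to_fract (varX * varY * varZ) * to_fract quotY"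
  "subst_rat cremona (to_fract quotZ) = - to_fract (varX * varY * varZ) * to_fract quotZ"
  unfolding subst_rat_to_fract
  by (simp_all add: cremona_def quotX_def quotY_def quotZ_def subst_poly_simps
      rhomD[OF rhom_subst_poly] algebra_simps)

section \<open>The field of invariants\<close>

lemma function_field_cremona_invariants: "function_field cremona_invariants"
proof -
  have "cremona_invariants = P2_functions \<inter> {f. subst_rat cremona f = f}"
    by (auto simp: cremona_invariants_def)
  then show ?thesis
    using function_field_Int[OF function_field_P2
        function_field_fixed[OF rhom_subst_rat[OF dominant_cremona] subst_rat_const]] by simp
qed

text \<open>The preimage of a field is a field, so it suffices to test X/Z and Y/Z; there the common
  factor -XYZ cancels.\<close>

lemma quotient_map_into_invariants: "subst_rat quotient_map ` P2_functions \<subseteq> cremona_invariants"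
proof -
  let ?s = "subst_rat quotient_map"
  note s = rhom_subst_rat[OF dominant_jacobian[OF jacobian_quotient_map]]
  note \<sigma> = rhom_subst_rat[OF dominant_cremona]
  have nz: "quotX \<noteq> 0" "quotY \<noteq> 0" "quotZ \<noteq> 0"
    using var_nonzero by (simp_all add: quotX_def quotY_def quotZ_def)
  have quot: "to_fract p / to_fract quotZ \<in> cremona_invariants"
    if "homogeneous 3 p" "subst_rat cremona (to_fract p) = - to_fract (varX * varY * varZ) * to_fract p" for p
  proof -
    have "Fract p quotZ \<in> P2_functions"
      using that(1) nz homogeneous_quot by (intro P2_functionsI)
    moreover have "subst_rat cremona (to_fract p / to_fract quotZ) = to_fract p / to_fract quotZ"
      using var_nonzero(1-3) by (simp add: rhom_divide[OF \<sigma>] that(2) cremona_quot)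
    ultimately show ?thesis by (simp add: cremona_invariants_def Fract_conv_to_fract)
  qed
  have "P2_functions \<subseteq> ?s -` cremona_invariants"
  proof (rule P2_functions_generated)
    show "function_field (?s -` cremona_invariants)"
      by (rule function_field_vimage[OF function_field_cremona_invariants s subst_rat_const])
    show "to_fract varX / to_fract varZ \<in> ?s -` cremona_invariants"
      "to_fract varY / to_fract varZ \<in> ?s -` cremona_invariants"
      using quot[OF homogeneous_quot(1) cremona_quot(1)] quot[OF homogeneous_quot(2) cremona_quot(2)]
      unfolding vimage_eq rhom_divide[OF s] subst_rat_to_fract
      by (simp_all add: quotient_map_def subst_poly_simps)
  qed
  then show ?thesis by blast
qed

text \<open>\<sigma> acts as the conjugation of \<open>R\<close> extended by \<open>a\<close>;
  inverses come from the norm of \<open>f\<close>, its product with its conjugate, which lies in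
  \<open>R\<close>.\<close>

lemma function_field_quadratic_extension:
  assumes R: "function_field R" and a: "a * a \<in> R"
    and \<sigma>: "rhom \<sigma>" "\<And>r. r \<in> R \<Longrightarrow> \<sigma> r = r" "\<sigma> a = - a"
  shows "function_field {r + a * s |r s. r \<in> R \<and> s \<in> R}" (is "function_field ?M")
proof -
  note R' = function_fieldD[OF R]
  have I: "r + a * s \<in> ?M" if "r \<in> R" "s \<in> R" for r s using that by blast
  have "const_rat c \<in> ?M" for c using I[OF R'(1) R'(2)] by simp
  moreover have "f + g \<in> ?M \<and> f * g \<in> ?M" if "f \<in> ?M" "g \<in> ?M" for f g
  proof -
    obtain r s r' s' where f: "f = r + a * s" "r \<in> R" "s \<in> R"
      and g: "g = r' + a * s'" "r' \<in> R" "s' \<in> R"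
      using \<open>f \<in> ?M\<close> \<open>g \<in> ?M\<close> by blast
    have eq: "f + g = (r + r') + a * (s + s')"
      "f * g = (r * r' + a * a * (s * s')) + a * (r * s' + s * r')"
      by (simp_all add: f g algebra_simps)
    show ?thesis
      unfolding eq using f g a by (intro conjI I) (simp_all add: R')
  qed
  moreover have "- f \<in> ?M \<and> inverse f \<in> ?M" if "f \<in> ?M" for f
  proof -
    obtain r s where f: "f = r + a * s" "r \<in> R" "s \<in> R" using \<open>f \<in> ?M\<close> by blast
    have \<sigma>f: "\<sigma> f = r - a * s" by (simp add: f \<sigma> rhomD[OF \<sigma>(1)])
    define n where "n = r * r - a * a * (s * s)"
    have n: "f * \<sigma> f = n" unfolding \<sigma>f n_def by (simp add: f(1) algebra_simps)
    have nR: "n \<in> R" using f a by (simp add: n_def R')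
    \<comment> \<open>For \<open>f = 0\<close> the norm is 0 too, and both sides are 0 by the
      convention for division by zero.\<close>
    have inv: "inverse f = r / n + a * (- s / n)"
    proof (cases "f = 0")
      case True
      then show ?thesis using n by simp
    next
      case False
      then have "n \<noteq> 0" using n rhom_divide(1)[OF \<sigma>(1), of f] by auto
      have "inverse f = \<sigma> f / n" using False n \<open>n \<noteq> 0\<close> by (simp add: field_simps)
      then show ?thesis by (simp add: \<sigma>f diff_divide_distrib)
    qed
    have minus: "- f = - r + a * - s" by (simp add: f)
    show ?thesis
      unfolding inv minus using f nR by (intro conjI I) (simp_all add: R')
  qed
  ultimately show ?thesis by (rule function_fieldI)
qed

lemma invariants_subset_quotient_map: "cremona_invariants \<subseteq> subst_rat quotient_map ` P2_functions"
proof
  let ?X = "to_fract varX" and ?Y = "to_fract varY" and ?Z = "to_fract varZ"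
  let ?s = "subst_rat quotient_map" and ?\<sigma> = "subst_rat cremona"
  note s = rhom_subst_rat[OF dominant_jacobian[OF jacobian_quotient_map]]
  note \<sigma> = rhom_subst_rat[OF dominant_cremona]
  note P2 = function_fieldD[OF function_field_P2]
  define R where "R = ?s ` P2_functions"
  have R: "function_field R"
    unfolding R_def by (rule function_field_image[OF function_field_P2 s subst_rat_const])
  note R' = function_fieldD[OF R]
  have fixed: "?\<sigma> r = r" if "r \<in> R" for r
    using that quotient_map_into_invariants by (auto simp: R_def cremona_invariants_def)
  have nz: "?X \<noteq> 0" "?Y \<noteq> 0" "?Z \<noteq> 0" "?X - ?Y \<noteq> 0" "?X + ?Y \<noteq> 0" "?X - ?Z \<noteq> 0" "?X + ?Z \<noteq> 0"
    "?Y - ?Z \<noteq> 0" "?Y + ?Z \<noteq> 0"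
    using var_nonzero
    by (simp_all add: to_fract_add[symmetric] to_fract_diff[symmetric] del: to_fract_add to_fract_diff)
  have two: "(2 :: ratfun) \<noteq> 0"
    by (metis rhom_numeral[OF rhom_to_fract] to_fract_eq_0_iff zero_neq_numeral)
  define a where "a = (?X - ?Z) / (?X + ?Z)"
  \<comment> \<open>This is b/a for b = (Y - Z)/(Y + Z), so that \<open>t * a\<close> recovers
    b.\<close>
  define t where "t = (?Y - ?Z) * (?X + ?Z) / ((?Y + ?Z) * (?X - ?Z))"
  have sxyz: "?s ?X = (?X - ?Y) * (?X + ?Z) * (?Y + ?Z)" "?s ?Y = - ((?X + ?Y) * (?X - ?Z) * (?Y + ?Z))"
    "?s ?Z = (?X + ?Y) * (?X + ?Z) * (?Y - ?Z)"
    by (simp_all add: subst_rat_to_fract quotient_map_def subst_poly_simps quotX_def quotY_def quotZ_def)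
  have xy: "?X / ?Z \<in> P2_functions" "?Y / ?Z \<in> P2_functions"
    using P2_functions_quotient[of 1] homogeneous_atoms(2,3) by fastforce+
  have "- (1 / (?Y / ?Z)) \<in> P2_functions"
    by (rule P2(4)[OF P2(9)[OF P2(3) xy(2)]])
  moreover have "?s (- (1 / (?Y / ?Z))) = - (?s ?Z / ?s ?Y)"
    by (simp add: rhom_divide[OF s] rhomD[OF s])
  moreover have "\<dots> = t"
    using nz unfolding sxyz t_def by (simp add: mult_ac)
  ultimately have t: "t \<in> R" unfolding R_def by (metis imageI)
  \<comment> \<open>The function -(x + y + z) y / (z x) in affine coordinates; its substitution is
    the square of \<open>a\<close>.\<close>
  have "- ((?X / ?Z + ?Y / ?Z + 1) * (?Y / ?Z) / (?X / ?Z)) \<in> P2_functions"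
    by (rule P2(4)[OF P2(9)[OF P2(8)[OF P2(6)[OF P2(6)[OF xy] P2(3)] xy(2)] xy(1)]])
  moreover have "?s (- ((?X / ?Z + ?Y / ?Z + 1) * (?Y / ?Z) / (?X / ?Z))) = a * a"
  proof -
    have sz: "?s ?Z \<noteq> 0" unfolding sxyz using nz by simp
    have "?s ?X + ?s ?Y + ?s ?Z = (?X - ?Y) * (?X - ?Z) * (?Y - ?Z)"
      unfolding sxyz by algebra
    moreover have "?s ?X / ?s ?Z + ?s ?Y / ?s ?Z + 1 = (?s ?X + ?s ?Y + ?s ?Z) / ?s ?Z"
      using sz by (simp add: add_divide_distrib)
    ultimately have "?s (- ((?X / ?Z + ?Y / ?Z + 1) * (?Y / ?Z) / (?X / ?Z))) =
        - (((?X - ?Y) * (?X - ?Z) * (?Y - ?Z)) / ?s ?Z * (?s ?Y / ?s ?Z) / (?s ?X / ?s ?Z))"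
      by (simp add: rhom_divide[OF s] rhomD[OF s])
    also have "\<dots> = a * a"
      using nz by (simp add: sxyz a_def)
    finally show ?thesis .
  qed
  ultimately have aa: "a * a \<in> R" unfolding R_def by (metis imageI)
  have "?\<sigma> ?X = ?Y * ?Z" "?\<sigma> ?Y = ?Z * ?X" "?\<sigma> ?Z = ?X * ?Y"
    by (simp_all add: subst_rat_to_fract cremona_def subst_poly_simps)
  then have "?\<sigma> a = (?Y * ?Z - ?X * ?Y) / (?Y * ?Z + ?X * ?Y)"
    by (simp add: a_def rhom_divide[OF \<sigma>] rhomD[OF \<sigma>])
  also have "\<dots> = - a"
  proof -
    have "?Y * ?Z + ?X * ?Y = ?Y * (?X + ?Z)" "?Y * ?Z - ?X * ?Y = ?Y * (?Z - ?X)"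
      by (simp_all add: algebra_simps)
    then show ?thesis using nz by (simp add: a_def diff_divide_distrib)
  qed
  finally have \<sigma>a: "?\<sigma> a = - a" .
  define M where "M = {r + a * s |r s. r \<in> R \<and> s \<in> R}"
  have M: "function_field M"
    unfolding M_def by (rule function_field_quadratic_extension[OF R aa \<sigma> fixed \<sigma>a])
  note M' = function_fieldD[OF M]
  have "0 + a * 1 \<in> M" unfolding M_def using R' by blast
  then have aM: "a \<in> M" by simp
  have "t + a * 0 \<in> M" unfolding M_def using R' t by blast
  then have tM: "t \<in> M" by simp
  \<comment> \<open>Inverse of the Moebius map that defines \<open>a\<close>; the same formula
    applied to \<open>t * a\<close> gives Y/Z.\<close>
  have "?X / ?Z = (1 + a) / (1 - a)"
  proof -
    have "1 + a = (?X + ?X) / (?X + ?Z)" "1 - a = (?Z + ?Z) / (?X + ?Z)"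
      using nz by (simp_all add: a_def field_simps)
    then show ?thesis using nz two by (simp flip: mult_2)
  qed
  then have "?X / ?Z \<in> M" using aM by (simp add: M')
  moreover have "?Y / ?Z = (1 + t * a) / (1 - t * a)"
  proof -
    have "t * a = (?Y - ?Z) / (?Y + ?Z)" using nz by (simp add: t_def a_def)
    then have "1 + t * a = (?Y + ?Y) / (?Y + ?Z)" "1 - t * a = (?Z + ?Z) / (?Y + ?Z)"
      using nz by (simp_all add: field_simps)
    then show ?thesis using nz two by (simp flip: mult_2)
  qed
  then have "?Y / ?Z \<in> M" using aM tM by (simp add: M')
  ultimately have PM: "P2_functions \<subseteq> M" by (rule P2_functions_generated[OF M])
  fix f assume f: "f \<in> cremona_invariants"
  then obtain r q where rq: "f = r + a * q" "r \<in> R" "q \<in> R"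
    using PM by (auto simp: cremona_invariants_def M_def)
  have "?\<sigma> f = r - a * q" using fixed rq by (simp add: rhomD[OF \<sigma>] \<sigma>a)
  \<comment> \<open>An invariant function equals its conjugate, so its part along \<open>a\<close>
    vanishes and \<open>f\<close> lies in \<open>R\<close>.\<close>
  then have "2 * (a * q) = 0" using f rq(1) by (simp add: cremona_invariants_def eq_diff_eq)
  then have "f = r" using two rq(1) by auto
  then show "f \<in> ?s ` P2_functions" using rq(2) unfolding R_def by metis
qed

lemma cremona_invariants_eq: "cremona_invariants = subst_rat quotient_map ` P2_functions"
  using quotient_map_into_invariants invariants_subset_quotient_map by (rule subset_antisym[rotated])

theorem theorem10:
  fixes l :: complex
  assumes "l \<noteq> 0" and "l \<noteq> 1"
  shows "P2_foliation 1 (F_foliation l) \<and> preserves_foliation cremona (F_foliation l) \<and>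
    P2_foliation 3 (G_foliation l) \<and>
    birationally_equivalent (cremona_quotient (F_foliation l)) (foliated_P2 (G_foliation l))"
proof -
  obtain A B C where G: "G_foliation l = (A, B, C)" by (cases "G_foliation l")
  have A: "A \<noteq> 0"
    using G by (auto simp: G_foliation_def varX_def varY_def varZ_def const3_def one_pCons)
  have fol: "P2_foliation 3 (G_foliation l)" using P2_foliation_G assms .
  have "birationally_equivalent (cremona_quotient (F_foliation l)) (foliated_P2 (G_foliation l))"
    unfolding cremona_quotient_def foliated_P2_def cremona_invariants_eq
  \<comment> \<open>With the invariants rewritten as the image of
    \<open>subst_rat quotient_map\<close>, the quotient surface is the pulled-back one.\<close>
  proof (rule birationally_equivalent_pullback[OF jacobian_quotient_map _ pullback_G])
    show "is_foliated_surface (P2_functions, induced_foliation P2_functions (G_foliation l))"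
      using foliated_surface_P2[of 3 A B C] fol A by (simp add: G foliated_P2_def)
    show "to_fract (- 8 * quotX * quotY * quotZ *
        ((varX - varY) * (varX - varZ) * (varY - varZ))) \<noteq> 0"
      unfolding to_fract_eq_0_iff using var_nonzero by (simp add: quotX_def quotY_def quotZ_def)
    show "rat_form (G_foliation l) \<noteq> 0" using A by (simp add: G rat_form_def zero_prod_def)
  qed
  then show ?thesis using P2_foliation_F preserves_F fol assms by blast
qed

end
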